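(* Let $d\ge1$, $r\ge1$ be integers, $\mathcal C$ the collection of Cartesian products of $d$ intervals of $\mathbb R$, and $\mathcal I\subset\mathcal C$ a countable partition of $\mathbb R^d$ satisfying the partition assumption stated in the context, with $h_0=\min_{I\in\mathcal I}\mu(I)>0$. Let $m=m(r,\mathcal I)$ and $$h_m=\frac{\bigl(1-\frac1{\sqrt2}\bigr)^{d+1}}{(2r^2)^d}\,h_0 .$$ Let $\hat p_m^{(h_m)}$ be the hun-estimator with tolerance $\delta>0$ based on the sets $C_{h_m}(p,q)=C_{h_m,m}(p-q)$, $p,q\in m$. Then $$\begin{aligned}\mathbb E\bigl[\|\hat p_m^{(h_m)}-p^\star\|_{\infty,\mu}\bigr]\le{}&5\inf_{p\in m}\|p-p^\star\|_{\infty,\mu}+274(2d+1)(3r)^{2d}\,\frac{\log(en)}{h_0n}+2\delta\\&+215\sqrt{2d+1}\,\min\left((3r)^d\sqrt{\|p^\star\|_{\infty,\mu}}\sqrt{\frac{\log(en)}{h_0n}},\;(3r)^{2d}\,\frac{\sqrt{\log(en)}}{h_0\sqrt n}\right).\end{aligned}$$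
   Context: $\mu$ is Lebesgue measure on $\mathbb R^d$, $\|\cdot\|_{\infty,\mu}$ the essential supremum norm. The observations $\mathbf X=(X_1,\dots,X_n)$ are independent (not necessarily identically distributed) random vectors in $\mathbb R^d$; $X_i$ has density $p_i^\star\in L_\infty(\mathbb R^d)$, and $p^\star=\frac1n\sum_{i=1}^np_i^\star$. $m(r,\mathcal I)$ is the set of functions $f=\sum_{I\in\mathcal I}f_I\mathbf 1_I$ where each $f_I$ is a polynomial function on $\mathbb R^d$ of total degree at most $r$ with rational coefficients, and $\{I:f_I\ne0\}$ is finite. Partition assumption: (i) $\{x+\lambda\mathring I:I\in\mathcal I,\ x\in\mathbb R^d,\ \lambda>0\}\subset\mathcal C$, where $\mathring I$ is the interior of $I$; (ii) $h_0:=\min_{I\in\mathcal I}\mu(I)>0$; (iii) the elements of $\mathcal I$ are bounded convex sets. The sets $C_{h,m}(f)$: for $u>0$ let $$\gamma_{r,d}(u)=\max\left(\frac1{2(d+1)}\Bigl[\frac{u^{-1}}{(2r^2)^d}\wedge1\Bigr],\ \Bigl[1-(2r^2)^{\frac d{d+1}}u^{\frac1{d+1}}\Bigr]_+^2\right),$$ and let $\theta_m(h)=\frac d{d+1}\frac1{2r^2}$ if $\gamma_{r,d}(h/h_0)=\frac1{2(d+1)}\bigl[\frac{h_0}{(2r^2)^dh}\wedge1\bigr]$, and $\theta_m(h)=\bigl(\frac h{2r^2h_0}\bigr)^{\frac1{d+1}}$ otherwise. For $f\in m$, let $I_*(f)\in\mathcal I$ be a cell at which $\sup_{I\in\mathcal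 I}\|f\mathbf 1_I\|_{\infty,\mu}$ is attained, let $f_*$ be the polynomial coinciding with $f$ on $I_*(f)$, let $x_*(f)$ be a point of $\overline{I_*(f)}$ at which $|f_*|$ attains its maximum over $\overline{I_*(f)}$, and set $C_{h,m}(f)=(1-\theta_m(h))x_*(f)+\theta_m(h)\mathring I_*(f)$. Hun-estimator: for $h>0$ and sets $C_h(p,q)\in\mathcal C$ ($p,q\in m$), let $\tau_h(p,q)\in\{-1,1\}$ be the sign of $\int_{C_h(p,q)}(p-q)d\mu$ (with $+1$, say, if zero), and $$T^{(h)}(\mathbf X,p,q)=\frac1n\sum_{i=1}^n\tau_h(p,q)\frac{\int_{C_h(p,q)}p\,d\mu-\mathbf 1_{C_h(p,q)}(X_i)}{\mu(C_h(p,q))+h},\qquad T_m^{(h)}(\mathbf X,p)=\sup_{q\in m}T^{(h)}(\mathbf X,p,q).$$ A hun-estimator with tolerance $\delta>0$ is any random element $\hat p_m^{(h)}\in m$ with $T_m^{(h)}(\mathbf X,\hat p_m^{(h)})\le\inf_{p\in m}T_m^{(h)}(\mathbf X,p)+\delta$. *)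

theory Defs
  imports "HOL-Probability.Probability" "HOL-Library.Disjoint_Sets"
begin

(* Essential supremum norm with respect to Lebesgue measure, with value top when f is not
   essentially bounded (also, by the convention of esssup, when |f| is not Borel measurable). *)
definition Linf_norm :: "('a::euclidean_space \<Rightarrow> real) \<Rightarrow> ennreal" where
  "Linf_norm f = esssup lborel (\<lambda>x. ennreal \<bar>f x\<bar>)"

definition interval_products :: "(real ^ 'd) set set" where
  "interval_products =
     {S. \<exists>J :: 'd \<Rightarrow> real set. (\<forall>i. is_interval (J i)) \<and> S = {x. \<forall>i. x $ i \<in> J i}}"

(* The multi-indices of total degree at most r form a finite set, as 'd is finite. *)
definition rat_polys :: "nat \<Rightarrow> (real ^ 'd \<Rightarrow> real) set" where
  "rat_polys r =
     {f. \<exists>c :: ('d \<Rightarrow> nat) \<Rightarrow> real. (\<forall>\<alpha>. c \<alpha> \<in> \<rat>) \<and>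
         f = (\<lambda>x. \<Sum>\<alpha> \<in> {\<alpha>. (\<Sum>i\<in>UNIV. \<alpha> i) \<le> r}. c \<alpha> * (\<Prod>i\<in>UNIV. (x $ i) ^ \<alpha> i))}"

definition pw_rat_polys :: "nat \<Rightarrow> (real ^ 'd) set set \<Rightarrow> (real ^ 'd \<Rightarrow> real) set" where
  "pw_rat_polys r \<I> =
     {f. \<exists>g. (\<forall>I\<in>\<I>. g I \<in> rat_polys r) \<and> finite {I\<in>\<I>. g I \<noteq> (\<lambda>_. 0)} \<and>
         f = (\<lambda>x. \<Sum>I \<in> {I\<in>\<I>. g I \<noteq> (\<lambda>_. 0)}. g I x * indicator I x)}"

(* The third conjunct says that h0 is the minimum (attained) of the volumes of the cells; the
   last one makes these volumes finite, so that the real-valued measure is the volume. *)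
definition partition_assumption ::
  "(real ^ 'd) set set \<Rightarrow> (real ^ 'd) set set \<Rightarrow> real \<Rightarrow> bool" where
  "partition_assumption \<C> \<I> h0 \<longleftrightarrow>
     (\<forall>I\<in>\<I>. \<forall>x. \<forall>t>0. (\<lambda>y. x + t *\<^sub>R y) ` interior I \<in> \<C>) \<and>
     h0 > 0 \<and>
     ((\<exists>I\<in>\<I>. measure lborel I = h0) \<and> (\<forall>I\<in>\<I>. h0 \<le> measure lborel I)) \<and>
     (\<forall>I\<in>\<I>. bounded I \<and> convex I)"

definition gamma_low :: "nat \<Rightarrow> nat \<Rightarrow> real \<Rightarrow> real" where
  "gamma_low r d u = 1 / (2 * (real d + 1)) * min (inverse u / (2 * real r ^ 2) ^ d) 1"

definition gamma_fun :: "nat \<Rightarrow> nat \<Rightarrow> real \<Rightarrow> real" where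
  "gamma_fun r d u =
     max (gamma_low r d u)
       ((max 0 (1 - (2 * real r ^ 2) powr (real d / (real d + 1)) * u powr (1 / (real d + 1)))) ^ 2)"

definition theta :: "nat \<Rightarrow> nat \<Rightarrow> real \<Rightarrow> real \<Rightarrow> real" where
  "theta r d h0 h =
     (if gamma_fun r d (h / h0) = gamma_low r d (h / h0)
      then real d / (real d + 1) * (1 / (2 * real r ^ 2))
      else (h / (2 * real r ^ 2 * h0)) powr (1 / (real d + 1)))"

(* (I, g, x) is an admissible choice of the triple (I_*(f), f_*, x_*(f)). *)
definition is_peak ::
  "nat \<Rightarrow> (real ^ 'd) set set \<Rightarrow> (real ^ 'd \<Rightarrow> real) \<Rightarrow>
   (real ^ 'd) set \<Rightarrow> (real ^ 'd \<Rightarrow> real) \<Rightarrow> real ^ 'd \<Rightarrow> bool" where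
  "is_peak r \<I> f I g x \<longleftrightarrow>
     I \<in> \<I> \<and>
     Linf_norm (\<lambda>y. f y * indicator I y) = (SUP J\<in>\<I>. Linf_norm (\<lambda>y. f y * indicator J y)) \<and>
     g \<in> rat_polys r \<and> (\<forall>y\<in>I. g y = f y) \<and>
     x \<in> closure I \<and> (\<forall>y\<in>closure I. \<bar>g y\<bar> \<le> \<bar>g x\<bar>)"

definition peak_set :: "real \<Rightarrow> (real ^ 'd) set \<Rightarrow> real ^ 'd \<Rightarrow> (real ^ 'd) set" where
  "peak_set t I x = (\<lambda>y. (1 - t) *\<^sub>R x + t *\<^sub>R y) ` interior I"

definition hun_sign ::
  "(real ^ 'd) set \<Rightarrow> (real ^ 'd \<Rightarrow> real) \<Rightarrow> (real ^ 'd \<Rightarrow> real) \<Rightarrow> real" where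
  "hun_sign A p q = (if (LINT x:A|lborel. p x - q x) \<ge> 0 then 1 else - 1)"

(* The observations are X 0, ..., X (n - 1); C p q is the set attached to the pair (p, q). *)
definition hun_T ::
  "nat \<Rightarrow> real \<Rightarrow> ((real ^ 'd \<Rightarrow> real) \<Rightarrow> (real ^ 'd \<Rightarrow> real) \<Rightarrow> (real ^ 'd) set) \<Rightarrow>
   (nat \<Rightarrow> real ^ 'd) \<Rightarrow> (real ^ 'd \<Rightarrow> real) \<Rightarrow> (real ^ 'd \<Rightarrow> real) \<Rightarrow> real" where
  "hun_T n h C X p q =
     (1 / real n) * (\<Sum>i<n. hun_sign (C p q) p q *
        (((LINT x:C p q|lborel. p x) - indicator (C p q) (X i)) / (measure lborel (C p q) + h)))"

definition hun_Tsup ::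
  "(real ^ 'd \<Rightarrow> real) set \<Rightarrow> nat \<Rightarrow> real \<Rightarrow>
   ((real ^ 'd \<Rightarrow> real) \<Rightarrow> (real ^ 'd \<Rightarrow> real) \<Rightarrow> (real ^ 'd) set) \<Rightarrow>
   (nat \<Rightarrow> real ^ 'd) \<Rightarrow> (real ^ 'd \<Rightarrow> real) \<Rightarrow> ereal" where
  "hun_Tsup m n h C X p = (SUP q\<in>m. ereal (hun_T n h C X p q))"

(* The model m is countable in the intended use, so that a random element of m is a map
   measurable with respect to the discrete sigma-algebra. *)
definition hun_estimator ::
  "'w measure \<Rightarrow> (real ^ 'd \<Rightarrow> real) set \<Rightarrow> nat \<Rightarrow> real \<Rightarrow>
   ((real ^ 'd \<Rightarrow> real) \<Rightarrow> (real ^ 'd \<Rightarrow> real) \<Rightarrow> (real ^ 'd) set) \<Rightarrow>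
   (nat \<Rightarrow> 'w \<Rightarrow> real ^ 'd) \<Rightarrow> real \<Rightarrow> ('w \<Rightarrow> real ^ 'd \<Rightarrow> real) \<Rightarrow> bool" where
  "hun_estimator P m n h C X \<delta> p_hat \<longleftrightarrow>
     p_hat \<in> measurable P (count_space m) \<and>
     (\<forall>\<omega>\<in>space P. hun_Tsup m n h C (\<lambda>i. X i \<omega>) (p_hat \<omega>)
        \<le> (INF p\<in>m. hun_Tsup m n h C (\<lambda>i. X i \<omega>) p) + ereal \<delta>)"

end

theory Submission
  imports Defs "HOL-Computational_Algebra.Polynomial"
begin

text \<open>The set attached to a pair \<open>(p, q)\<close> is a shrunken copy, near the peak of \<open>p - q\<close>, of the cell where
  \<open>p - q\<close> peaks. A polynomial cannot decay quickly away from a peak, so the integral of \<open>p - q\<close> over this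
  box, normalised by volume plus \<open>hm\<close>, is at least half of the norm of \<open>p - q\<close>. Comparing
  with an arbitrary \<open>pbar\<close> in the model bounds the loss by \<open>5 \<parallel>pbar - pstar\<parallel> + 2\<delta> + 4 Z\<close>,
  where \<open>Z\<close> is the supremum over boxes of the normalised deviation between empirical and true mass.

  The expectation of \<open>Z\<close> is controlled by bracketing rather than by symmetrisation: at
  resolution \<open>1/n\<close> every box lies between two out of at most \<open>2 (n+1)^(2d)\<close> fixed boxes
  whose masses differ by at most \<open>2d/n\<close>, and Bernstein's inequality applies to all of them at once. Bounding
  the variance by \<open>\<parallel>pstar\<parallel>\<close> times the volume, or simply by 1, gives the two terms of the minimum.\<close>

section \<open>Decay of polynomials near a maximum\<close>

text \<open>The bandwidth fixes the constants. Put \<open>\<kappa> = 1 - 1/sqrt 2\<close>; then the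
  shrinking ratio is \<open>t = \<kappa> / (2 r^2)\<close> and \<open>hm = \<kappa> t^d h0\<close>.
  Comparison with Chebyshev polynomials shows that a fraction \<open>1 - 2 r^2 t = 1/sqrt 2\<close>
  of the peak survives on the whole box, while \<open>hm\<close> enlarges the normalising volume by
  a factor of at most \<open>1 + \<kappa>\<close>. The quotient is
  \<open>1 / (2 sqrt 2 - 1)\<close>, which exceeds \<open>1/2\<close>. Moreover
  \<open>\<kappa> \<ge> 2/9\<close> gives \<open>t \<ge> 1/(3r)^2\<close>, so every box has volume
  at least \<open>h0 / (3r)^(2d)\<close>: this is where the powers of \<open>3r\<close> come from.

  The obstacle is that the box attached to the estimator is random, so the deviation must be
  controlled over uncountably many boxes at once. The supremum itself is never integrated: for every
  box it is dominated by an affine function of one measurable variable \<open>R\<close> with a known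
  bound on its mean. The brackets are built for the average of the laws of the observations, and
  only the sum of their probabilities enters the exponential moments, which accommodates
  observations with different laws.\<close>

lemma ex_chebyshev_poly:
  "\<exists>T :: real poly. degree T \<le> k \<and> (\<forall>x. poly T (cos x) = cos (real k * x))"
proof (induction k rule: induct_nat_012)
  case 0
  show ?case by (intro exI[of _ 1]) simp
next
  case 1
  show ?case by (intro exI[of _ "[:0, 1:]"]) simp
next
  case (ge2 k)
  then obtain T U :: "real poly"
    where T: "degree T \<le> k" "\<And>x. poly T (cos x) = cos (real k * x)"
      and U: "degree U \<le> Suc k" "\<And>x. poly U (cos x) = cos (real (Suc k) * x)"
    by blast
  \<comment> \<open>The three-term recurrence \<open>T (k+2) = 2 x T (k+1) - T k\<close>, which at
    \<open>cos x\<close> is the formula for \<open>cos (a + x) + cos (a - x)\<close> with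
    \<open>a = (k+1) x\<close>.\<close>
  have "degree ([:0, 2:] * U) \<le> Suc (Suc k)"
    using degree_mult_le[of "[:0, 2:]" U] U(1) by simp
  then have "degree ([:0, 2:] * U - T) \<le> Suc (Suc k)"
    using T(1) by (intro degree_diff_le) auto
  moreover have "poly ([:0, 2:] * U - T) (cos x) = cos (real (Suc (Suc k)) * x)" for x
  proof -
    have "real (Suc (Suc k)) * x = real (Suc k) * x + x" "real k * x = real (Suc k) * x - x"
      by (simp_all add: algebra_simps)
    then have "cos (real (Suc (Suc k)) * x) + cos (real k * x) = 2 * (cos x * cos (real (Suc k) * x))"
      by (simp only: cos_add cos_diff) simp
    then show ?thesis by (simp add: T(2) U(2) del: of_nat_Suc)
  qed
  ultimately show ?case by blast
qed

text \<open>Both sides have degree at most \<open>r\<close> and agree at \<open>r + 1\<close>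
  distinct nodes. The right side is built as an actual polynomial \<open>E\<close> so that this
  uniqueness argument applies to it.\<close>

lemma lagrange_interpolation:
  fixes D :: "real poly" and u :: "nat \<Rightarrow> real"
  assumes deg: "degree D \<le> r" and inj: "inj_on u {..r}"
  shows "poly D x = (\<Sum>k\<le>r. poly D (u k) * (\<Prod>j\<in>{..r} - {k}. (x - u j) / (u k - u j)))"
proof -
  define l where "l k = (\<Prod>j\<in>{..r} - {k}. smult (1 / (u k - u j)) [:- u j, 1:])" for k
  define E where "E = (\<Sum>k\<le>r. smult (poly D (u k)) (l k))"
  have poly_l: "poly (l k) y = (\<Prod>j\<in>{..r} - {k}. (y - u j) / (u k - u j))" for k y
  proof -
    have "poly (smult (1 / c) [:- a, 1:]) y = (y - a) / c" for a c :: real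
      by (simp add: diff_divide_distrib)
    then show ?thesis by (simp only: l_def poly_prod)
  qed
  have poly_E: "poly E y = (\<Sum>k\<le>r. poly D (u k) * (\<Prod>j\<in>{..r} - {k}. (y - u j) / (u k - u j)))" for y
    by (simp add: E_def poly_sum poly_l)
  have l_node: "poly (l k) (u i) = (if i = k then 1 else 0)" if "k \<le> r" "i \<le> r" for k i
  proof (cases "i = k")
    case True
    have "u k - u j \<noteq> 0" if "j \<in> {..r} - {k}" for j
      using inj that \<open>k \<le> r\<close> by (auto simp: inj_on_def)
    then show ?thesis by (simp add: poly_l True)
  next
    case False
    then have "i \<in> {..r} - {k}" using that by auto
    then have "poly (l k) (u i) = 0"
      unfolding poly_l by (intro prod_zero) auto
    then show ?thesis using False by simp
  qed
  have "degree (l k) \<le> r" if "k \<le> r" for k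
  proof -
    have "degree (l k) \<le> (\<Sum>j\<in>{..r} - {k}. degree (smult (1 / (u k - u j)) [:- u j, 1:]))"
      unfolding l_def by (rule degree_prod_sum_le[unfolded o_def]) simp
    also have "\<dots> \<le> (\<Sum>j\<in>{..r} - {k}. 1)"
      by (intro sum_mono) simp
    also have "\<dots> = r" using that by simp
    finally show ?thesis .
  qed
  then have "degree E \<le> r"
    unfolding E_def by (intro degree_sum_le order_trans[OF degree_smult_le]) simp_all
  have E_node: "poly E (u i) = poly D (u i)" if "i \<le> r" for i
  proof -
    have "poly E (u i) = (\<Sum>k\<le>r. if k = i then poly D (u k) else 0)"
      unfolding E_def poly_sum poly_smult using that by (intro sum.cong) (simp_all add: l_node)
    then show ?thesis using that by simp
  qed
  have "card (u ` {..r}) = Suc r" using inj by (simp add: card_image)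
  moreover have "poly D x = poly E x" if "x \<in> u ` {..r}" for x
    using that E_node by auto
  ultimately have "D = E"
    using deg \<open>degree E \<le> r\<close> by (intro poly_eqI_degree[of "u ` {..r}"]) simp_all
  then have "poly D x = poly E x" by (rule arg_cong)
  also note poly_E
  finally show ?thesis .
qed

text \<open>In the Lagrange basis at the extremal points \<open>cos (k\<pi>/r)\<close> of the Chebyshev polynomial
  \<open>T\<close>, the difference \<open>q - T\<close> has only nonnegative terms to the right of \<open>cos (\<pi>/r)\<close>.\<close>

lemma poly_ge_chebyshev:
  fixes q :: "real poly"
  assumes r: "r \<ge> 1" and deg: "degree q \<le> r"
    and bd: "\<And>x. \<bar>x\<bar> \<le> 1 \<Longrightarrow> \<bar>poly q x\<bar> \<le> 1" and q1: "poly q 1 = 1"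
    and \<phi>: "0 \<le> \<phi>" "\<phi> \<le> pi / r"
  shows "cos (r * \<phi>) \<le> poly q (cos \<phi>)"
proof -
  obtain T :: "real poly" where T: "degree T \<le> r" "\<And>x. poly T (cos x) = cos (real r * x)"
    using ex_chebyshev_poly by blast
  \<comment> \<open>The nodes decrease with \<open>k\<close>, from \<open>u 0 = 1\<close> to
    \<open>u r = -1\<close>, and \<open>T\<close> alternates between 1 and -1 on them.\<close>
  define u where "u k = cos (real k * pi / real r)" for k :: nat
  define l where "l k = (\<Prod>j\<in>{..r} - {k}. (cos \<phi> - u j) / (u k - u j))" for k
  have ang: "0 \<le> real k * pi / real r \<and> real k * pi / real r \<le> pi" if "k \<le> r" for k
    using that r by (simp add: field_simps)
  have less: "u j < u k" if "k < j" "j \<le> r" for j k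
    unfolding u_def using that r ang[of k] ang[of j]
    by (intro cos_monotone_0_pi) (auto intro!: divide_strict_right_mono)
  have inj: "inj_on u {..r}"
  proof (rule linorder_inj_onI')
    fix i j assume "i \<in> {..r}" "j \<in> {..r}" "i < j"
    then show "u i \<noteq> u j" using less[of i j] by simp
  qed
  have uT: "poly T (u k) = (- 1) ^ k" for k
    using r by (simp add: u_def T(2) cos_npi)
  have "poly (q - T) (cos \<phi>) = (\<Sum>k\<le>r. poly (q - T) (u k) * l k)"
    unfolding l_def using lagrange_interpolation[OF _ inj] deg T(1) degree_diff_le by blast
  also have "\<dots> \<ge> 0"
  proof (rule sum_nonneg)
    fix k assume "k \<in> {..r}"
    then have k: "k \<le> r" by simp
    show "0 \<le> poly (q - T) (u k) * l k"
    proof (cases "k = 0")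
      \<comment> \<open>At the node \<open>u 0 = 1\<close> both polynomials equal 1, so this term
        vanishes.\<close>
      case True
      then show ?thesis using uT[of 0] q1 by (simp add: u_def)
    next
      case False
      have split: "{..r} - {k} = {..<k} \<union> {k<..r}" using k by auto
      have num: "cos \<phi> - u j \<ge> 0" if "1 \<le> j" "j \<le> r" for j
      proof -
        have "pi / real r \<le> real j * pi / real r"
          using that(1) by (intro divide_right_mono) auto
        then have "\<phi> \<le> real j * pi / real r"
          using \<phi>(2) by linarith
        then show ?thesis
          using \<phi>(1) ang[OF that(2)] cos_monotone_0_pi_le[of \<phi> "real j * pi / real r"]
          by (simp add: u_def)
      qed
      \<comment> \<open>For \<open>j < k\<close> the denominators are negative; pulling out their
        signs produces the same \<open>(- 1) ^ k\<close> as the value of \<open>T\<close> at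
        \<open>u k\<close>.\<close>
      have "(\<Prod>j<k. (cos \<phi> - u j) / (u k - u j)) = (- 1) ^ k * (\<Prod>j<k. (cos \<phi> - u j) / (u j - u k))"
      proof -
        have "(\<Prod>j<k. (cos \<phi> - u j) / (u k - u j)) = (\<Prod>j<k. (- 1) * ((cos \<phi> - u j) / (u j - u k)))"
        proof (rule prod.cong)
          fix j
          have "u k - u j = - (u j - u k)" by simp
          then show "(cos \<phi> - u j) / (u k - u j) = - 1 * ((cos \<phi> - u j) / (u j - u k))"
            by (metis minus_divide_right mult_minus1)
        qed simp
        then show ?thesis by (simp only: prod.distrib prod_constant card_lessThan)
      qed
      \<comment> \<open>The only nonpositive factor is \<open>j = 0\<close>: the angle bound places
        \<open>cos \<phi>\<close> to the right of all nodes except \<open>u 0 = 1\<close>.\<close>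
      moreover have "(\<Prod>j<k. (cos \<phi> - u j) / (u j - u k)) \<le> 0"
      proof -
        have "(\<Prod>j<k. (cos \<phi> - u j) / (u j - u k))
            = (cos \<phi> - u 0) / (u 0 - u k) * (\<Prod>j\<in>{1..<k}. (cos \<phi> - u j) / (u j - u k))"
          using False by (simp add: lessThan_atLeast0 prod.atLeast_Suc_lessThan)
        moreover have "(cos \<phi> - u 0) / (u 0 - u k) \<le> 0"
          using less[of 0 k] False k by (intro divide_nonpos_pos) (auto simp: u_def)
        moreover have "(\<Prod>j\<in>{1..<k}. (cos \<phi> - u j) / (u j - u k)) \<ge> 0"
        proof (intro prod_nonneg ballI)
          fix j assume "j \<in> {1..<k}"
          then show "0 \<le> (cos \<phi> - u j) / (u j - u k)"
            using num[of j] less[of j k] k by (intro divide_nonneg_pos) auto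
        qed
        ultimately show ?thesis by (simp only: mult_nonpos_nonneg)
      qed
      moreover have "(\<Prod>j\<in>{k<..r}. (cos \<phi> - u j) / (u k - u j)) \<ge> 0"
      proof (intro prod_nonneg ballI)
        fix j assume "j \<in> {k<..r}"
        then show "0 \<le> (cos \<phi> - u j) / (u k - u j)"
          using num[of j] less[of k j] by (intro divide_nonneg_pos) auto
      qed
      ultimately have c0: "(\<Prod>j<k. (cos \<phi> - u j) / (u j - u k)) *
          (\<Prod>j\<in>{k<..r}. (cos \<phi> - u j) / (u k - u j)) \<le> 0"
        and prod_k: "(\<Prod>j<k. (cos \<phi> - u j) / (u k - u j))
          = (- 1) ^ k * (\<Prod>j<k. (cos \<phi> - u j) / (u j - u k))"
        by (simp_all only: mult_nonpos_nonneg)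
      define c where "c = (\<Prod>j<k. (cos \<phi> - u j) / (u j - u k)) *
          (\<Prod>j\<in>{k<..r}. (cos \<phi> - u j) / (u k - u j))"
      have "l k = (\<Prod>j<k. (cos \<phi> - u j) / (u k - u j)) * (\<Prod>j\<in>{k<..r}. (cos \<phi> - u j) / (u k - u j))"
        unfolding l_def split by (rule prod.union_disjoint) auto
      then have c: "l k = (- 1) ^ k * c" "c \<le> 0"
        using c0 by (simp_all only: c_def prod_k mult.assoc)
      have "\<bar>poly q (u k)\<bar> \<le> 1" by (intro bd) (simp add: u_def)
      \<comment> \<open>Since \<open>q\<close> is bounded by 1 in absolute value and
        \<open>T\<close> equals plus or minus 1 here, the sign of \<open>q - T\<close> is opposite
        to that of \<open>T\<close>, or the difference is 0.\<close>
      then have "poly (q - T) (u k) * (- 1) ^ k \<le> 0"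
        unfolding poly_diff uT by (cases "even k") auto
      then have "(poly (q - T) (u k) * (- 1) ^ k) * c \<ge> 0"
        using c(2) by (rule mult_nonpos_nonpos)
      then show ?thesis by (simp add: c(1) mult.assoc)
    qed
  qed
  finally show ?thesis by (simp add: T(2))
qed

text \<open>Serves twice in the next lemma: at \<open>pi / (2 r)\<close> it gives
  \<open>sin (pi / (2 r)) \<ge> 1/r\<close>, and at half the angle it turns
  \<open>cos (r \<phi>)\<close> into a bound linear in \<open>s\<close>.\<close>

lemma abs_sin_nat_mult_le: "\<bar>sin (real k * x)\<bar> \<le> real k * \<bar>sin x\<bar>"
proof (induction k)
  case (Suc k)
  have "real (Suc k) * x = real k * x + x" by (simp add: algebra_simps)
  then have "\<bar>sin (real (Suc k) * x)\<bar> = \<bar>sin (real k * x) * cos x + cos (real k * x) * sin x\<bar>"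
    by (simp only: sin_add)
  also have "\<dots> \<le> \<bar>sin (real k * x)\<bar> * \<bar>cos x\<bar> + \<bar>cos (real k * x)\<bar> * \<bar>sin x\<bar>"
    by (metis abs_mult abs_triangle_ineq)
  also have "\<dots> \<le> \<bar>sin (real k * x)\<bar> * 1 + 1 * \<bar>sin x\<bar>"
    by (intro add_mono mult_mono) auto
  finally show ?case using Suc.IH by (simp add: algebra_simps)
qed simp

text \<open>This is the bound that Markov's inequality for derivatives would give.\<close>

lemma poly_endpoint_decay:
  fixes q :: "real poly"
  assumes r: "r \<ge> 1" and deg: "degree q \<le> r"
    and bd: "\<And>t. 0 \<le> t \<Longrightarrow> t \<le> 1 \<Longrightarrow> \<bar>poly q t\<bar> \<le> \<bar>poly q 0\<bar>"
    and s: "0 \<le> s" "s \<le> 1 / (real r)\<^sup>2"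
  shows "(1 - 2 * (real r)\<^sup>2 * s) * \<bar>poly q 0\<bar> \<le> sgn (poly q 0) * poly q s"
proof (cases "poly q 0 = 0")
  case False
  \<comment> \<open>The substitution \<open>t = (1 - x) / 2\<close> carries \<open>[-1, 1]\<close>
    to \<open>[0, 1]\<close> and the end \<open>x = 1\<close> to the peak at 0; division by the peak
    value gives \<open>Q\<close> the value 1 there.\<close>
  define Q where "Q = smult (1 / poly q 0) (q \<circ>\<^sub>p [:1/2, -1/2:])"
  have Q: "poly Q x = poly q ((1 - x) / 2) / poly q 0" for x
    by (simp add: Q_def poly_pcompose diff_divide_distrib)
  have "degree Q \<le> degree q * degree [:1/2, -1/2::real:]"
    unfolding Q_def using degree_smult_le order_trans[OF _ degree_pcompose_le] by blast
  then have "degree Q \<le> r" using deg by simp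
  moreover have "poly Q 1 = 1" using False by (simp add: Q)
  moreover have "\<bar>poly Q x\<bar> \<le> 1" if "\<bar>x\<bar> \<le> 1" for x
    using bd[of "(1 - x) / 2"] that False by (auto simp: Q abs_divide divide_le_eq)
  moreover have r2: "(real r)\<^sup>2 \<ge> 1" using r by simp
  then have "1 / (real r)\<^sup>2 \<le> 1" by (subst divide_le_eq_1_pos) linarith+
  then have s1: "s \<le> 1" using s(2) by linarith
  define \<phi> where "\<phi> = arccos (1 - 2 * s)"
  have cos\<phi>: "cos \<phi> = 1 - 2 * s" unfolding \<phi>_def using s(1) s1 by (intro cos_arccos) linarith+
  have \<phi>: "0 \<le> \<phi>" "\<phi> \<le> pi" unfolding \<phi>_def using s(1) s1 arccos_lbound[of "1 - 2 * s"] arccos_ubound[of "1 - 2 * s"] by linarith+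
  have sin2: "(sin (\<phi> / 2))\<^sup>2 = s"
  proof -
    have "cos \<phi> = 1 - 2 * (sin (\<phi> / 2))\<^sup>2" using cos_double_sin[of "\<phi> / 2"] by simp
    then show ?thesis using cos\<phi> by linarith
  qed
  \<comment> \<open>The restriction on \<open>s\<close> enters here:
    \<open>sin (\<phi>/2) = sqrt s \<le> 1/r \<le> sin (pi / (2 r))\<close>, which keeps the angle
    in the range of the Chebyshev comparison.\<close>
  have "\<phi> \<le> pi / r"
  proof (rule ccontr)
    assume "\<not> \<phi> \<le> pi / r"
    then have "(pi / r) / 2 < \<phi> / 2" by simp
    then have "pi / (2 * r) < \<phi> / 2" by simp
    moreover have "\<phi> / 2 \<le> pi / 2" using \<phi> by simp
    moreover have "- (pi / 2) \<le> pi / (2 * r)"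
      by (rule order_trans[of _ 0]) auto
    ultimately have "sin (pi / (2 * r)) < sin (\<phi> / 2)"
      by (intro sin_monotone_2pi)
    moreover have "1 / r \<le> sin (pi / (2 * r))"
    proof -
      have "real r * (pi / (2 * r)) = pi / 2" using r by simp
      then have "1 \<le> real r * \<bar>sin (pi / (2 * r))\<bar>"
        using abs_sin_nat_mult_le[of r "pi / (2 * r)"] by (metis abs_one sin_pi_half)
      moreover have "pi / (2 * r) \<le> pi" using r by (simp add: divide_le_eq)
      then have "0 \<le> sin (pi / (2 * r))" by (intro sin_ge_zero) auto
      ultimately show ?thesis using r by (simp add: divide_le_eq mult.commute)
    qed
    ultimately have "1 / r < sin (\<phi> / 2)" by simp
    then have "(1 / r)\<^sup>2 < (sin (\<phi> / 2))\<^sup>2"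
      by (intro power_strict_mono) auto
    then show False using sin2 s(2) by (simp add: power_divide)
  qed
  ultimately have "cos (r * \<phi>) \<le> poly Q (cos \<phi>)"
    using r \<phi> by (intro poly_ge_chebyshev) auto
  \<comment> \<open>Half-angle formula: \<open>cos (r \<phi>) = 1 - 2 sin^2 (r \<phi> / 2)\<close>,
    and the last square is at most \<open>r^2 sin^2 (\<phi>/2) = r^2 s\<close>.\<close>
  moreover have "1 - 2 * (real r)\<^sup>2 * s \<le> cos (r * \<phi>)"
  proof -
    have "\<bar>sin (r * (\<phi> / 2))\<bar>\<^sup>2 \<le> (r * \<bar>sin (\<phi> / 2)\<bar>)\<^sup>2"
      by (intro power_mono abs_sin_nat_mult_le) auto
    also have "\<dots> = r\<^sup>2 * s" by (simp add: power_mult_distrib sin2)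
    finally show ?thesis using cos_double_sin[of "r * (\<phi> / 2)"] by simp
  qed
  ultimately have "1 - 2 * (real r)\<^sup>2 * s \<le> poly q s / poly q 0"
    by (simp add: Q cos\<phi>)
  then have "(1 - 2 * (real r)\<^sup>2 * s) * \<bar>poly q 0\<bar> \<le> poly q s / poly q 0 * \<bar>poly q 0\<bar>"
    by (intro mult_right_mono) auto
  then show ?thesis using False by (simp add: sgn_real_def abs_if split: if_splits)
qed simp

section \<open>Piecewise polynomials and peak sets\<close>

lemma sets_borel_interval_products:
  assumes "I \<in> interval_products"
  shows "I \<in> sets borel"
proof -
  obtain J :: "'a \<Rightarrow> real set" where J: "\<And>i. is_interval (J i)" "I = {x. \<forall>i. x $ i \<in> J i}"
    using assms by (auto simp: interval_products_def)
  have "J i \<in> sets borel" for i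
    using J(1) by (rule real_interval_borel_measurable)
  then have "(\<Inter>i. (\<lambda>x :: real ^ 'a. x $ i) -` J i \<inter> space borel) \<in> sets borel"
    by (intro sets.finite_INT measurable_sets[OF borel_measurable_nth]) auto
  also have "(\<Inter>i. (\<lambda>x :: real ^ 'a. x $ i) -` J i \<inter> space borel) = I"
    unfolding J(2) by auto
  finally show ?thesis .
qed

text \<open>Reduces the decay near a peak to one variable: restricting to a line turns the bound on
  the total degree into a bound on the ordinary degree.\<close>

lemma rat_polys_along_line:
  assumes "g \<in> rat_polys r"
  obtains q :: "real poly" where "degree q \<le> r" and "\<And>t. poly q t = g (x + t *\<^sub>R y)"
proof -
  define S where "S = {\<alpha> :: 'a \<Rightarrow> nat. (\<Sum>i\<in>UNIV. \<alpha> i) \<le> r}"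
  obtain c :: "('a \<Rightarrow> nat) \<Rightarrow> real" where c: "g = (\<lambda>x. \<Sum>\<alpha>\<in>S. c \<alpha> * (\<Prod>i\<in>UNIV. (x $ i) ^ \<alpha> i))"
    using assms by (auto simp: rat_polys_def S_def)
  define p where "p \<alpha> = (\<Prod>i\<in>UNIV. [:x $ i, y $ i:] ^ \<alpha> i)" for \<alpha> :: "'a \<Rightarrow> nat"
  have "degree (p \<alpha>) \<le> r" if "\<alpha> \<in> S" for \<alpha>
  proof -
    have "degree (p \<alpha>) \<le> (\<Sum>i\<in>UNIV. degree ([:x $ i, y $ i:] ^ \<alpha> i))"
      unfolding p_def by (rule degree_prod_sum_le[unfolded o_def]) simp
    also have "\<dots> \<le> (\<Sum>i\<in>UNIV. \<alpha> i)"
    proof (rule sum_mono)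
      fix i
      have "degree ([:x $ i, y $ i:] ^ \<alpha> i) \<le> degree [:x $ i, y $ i:] * \<alpha> i"
        by (rule degree_power_le)
      also have "\<dots> \<le> 1 * \<alpha> i" by (intro mult_right_mono) auto
      finally show "degree ([:x $ i, y $ i:] ^ \<alpha> i) \<le> \<alpha> i" by simp
    qed
    finally show ?thesis using that by (simp add: S_def)
  qed
  then have deg: "degree (smult (c \<alpha>) (p \<alpha>)) \<le> r" if "\<alpha> \<in> S" for \<alpha>
    using that degree_smult_le order_trans by blast
  show thesis
  proof (rule that)
    show "degree (\<Sum>\<alpha>\<in>S. smult (c \<alpha>) (p \<alpha>)) \<le> r"
      \<comment> \<open>For an infinite index set the sum is 0 by convention, and this also has
        degree at most \<open>r\<close>.\<close>
      using deg by (cases "finite S") (auto intro: degree_sum_le)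
    show "poly (\<Sum>\<alpha>\<in>S. smult (c \<alpha>) (p \<alpha>)) t = g (x + t *\<^sub>R y)" for t
      by (simp add: c poly_sum p_def poly_prod mult.commute)
  qed
qed

lemma continuous_on_rat_polys: "g \<in> rat_polys r \<Longrightarrow> continuous_on S g"
  by (auto simp: rat_polys_def intro!: continuous_intros)

lemma rat_polys_diff:
  assumes "f \<in> rat_polys r" "g \<in> rat_polys r"
  shows "(\<lambda>x. f x - g x) \<in> rat_polys r"
proof -
  obtain b c :: "('a \<Rightarrow> nat) \<Rightarrow> real" where
    "\<forall>\<alpha>. b \<alpha> \<in> \<rat>" "f = (\<lambda>x. \<Sum>\<alpha>\<in>{\<alpha>. (\<Sum>i\<in>UNIV. \<alpha> i) \<le> r}. b \<alpha> * (\<Prod>i\<in>UNIV. (x $ i) ^ \<alpha> i))"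
    "\<forall>\<alpha>. c \<alpha> \<in> \<rat>" "g = (\<lambda>x. \<Sum>\<alpha>\<in>{\<alpha>. (\<Sum>i\<in>UNIV. \<alpha> i) \<le> r}. c \<alpha> * (\<Prod>i\<in>UNIV. (x $ i) ^ \<alpha> i))"
    using assms unfolding rat_polys_def by blast
  then show ?thesis
    unfolding rat_polys_def
    by (auto intro!: exI[of _ "\<lambda>\<alpha>. b \<alpha> - c \<alpha>"] simp: left_diff_distrib sum_subtractf)
qed

text \<open>The box of a pair is chosen through the difference of its members, and peaks are
  supplied only for elements of the model; hence the model must be closed under subtraction.\<close>

lemma pw_rat_polys_diff:
  assumes "f \<in> pw_rat_polys r \<I>" "f' \<in> pw_rat_polys r \<I>"
  shows "(\<lambda>x. f x - f' x) \<in> pw_rat_polys r \<I>"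
proof -
  define S where "S g = {I\<in>\<I>. g I \<noteq> (\<lambda>_. 0)}" for g :: "(real ^ 'a) set \<Rightarrow> real ^ 'a \<Rightarrow> real"
  obtain g where g: "\<forall>I\<in>\<I>. g I \<in> rat_polys r" "finite (S g)" "f = (\<lambda>x. \<Sum>I\<in>S g. g I x * indicator I x)"
    using assms(1) unfolding pw_rat_polys_def S_def by blast
  obtain g' where g': "\<forall>I\<in>\<I>. g' I \<in> rat_polys r" "finite (S g')" "f' = (\<lambda>x. \<Sum>I\<in>S g'. g' I x * indicator I x)"
    using assms(2) unfolding pw_rat_polys_def S_def by blast
  define G where "G I x = g I x - g' I x" for I x
  have sub: "S G \<subseteq> S g \<union> S g'" by (auto simp: S_def G_def)
  have fin: "finite (S g \<union> S g')" using g g' by simp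
  \<comment> \<open>The pieces may cancel on a cell, so the three supports differ; all sums are
    first extended by zero terms to a common finite set.\<close>
  have ext: "(\<Sum>I\<in>S h. h I x * indicator I x) = (\<Sum>I\<in>S g \<union> S g'. h I x * indicator I x)"
    if "S h \<subseteq> S g \<union> S g'" for h x
    by (rule sum.mono_neutral_left) (use fin that in \<open>auto simp: S_def\<close>)
  have "f x - f' x = (\<Sum>I\<in>S G. G I x * indicator I x)" for x
    unfolding g(3) g'(3) ext[OF sub] ext[OF Un_upper1] ext[OF Un_upper2]
    by (simp add: G_def left_diff_distrib sum_subtractf)
  moreover have "\<forall>I\<in>\<I>. G I \<in> rat_polys r"
    using g(1) g'(1) rat_polys_diff unfolding G_def by blast
  moreover have "finite (S G)" using sub fin by (rule finite_subset)
  ultimately show ?thesis unfolding pw_rat_polys_def S_def by blast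
qed

lemma integrable_pw_rat_polys:
  assumes f: "f \<in> pw_rat_polys r \<I>" and I: "\<And>I. I \<in> \<I> \<Longrightarrow> I \<in> sets borel \<and> bounded I"
  shows "integrable lborel f"
proof -
  define S where "S g = {I\<in>\<I>. g I \<noteq> (\<lambda>_. 0)}" for g :: "(real ^ 'a) set \<Rightarrow> real ^ 'a \<Rightarrow> real"
  obtain g where g: "\<forall>I\<in>\<I>. g I \<in> rat_polys r" "finite (S g)" "f = (\<lambda>x. \<Sum>I\<in>S g. g I x * indicator I x)"
    using f unfolding pw_rat_polys_def S_def by blast
  have "integrable lborel (\<lambda>x. g I x * indicator I x)" if "I \<in> S g" for I
  proof -
    have I': "I \<in> \<I>" using that by (simp add: S_def)
    \<comment> \<open>Cells need not be closed: continuity gives integrability on the compact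
      closure, and the result is then cut down to the cell.\<close>
    have "integrable lborel (\<lambda>x. indicator (closure I) x *\<^sub>R g I x)"
      using I[OF I'] g(1) I' continuous_on_rat_polys
      by (intro borel_integrable_compact) (auto simp: compact_closure)
    then have "integrable lborel (\<lambda>x. indicator I x *\<^sub>R (indicator (closure I) x *\<^sub>R g I x))"
      using I[OF I'] by (intro integrable_mult_indicator[of I]) simp_all
    moreover have "indicator I x *\<^sub>R (indicator (closure I) x *\<^sub>R g I x) = g I x * indicator I x" for x
      using closure_subset[of I] by (auto simp: indicator_def)
    ultimately show ?thesis by (simp only:)
  qed
  then show ?thesis unfolding g(3) by (intro Bochner_Integration.integrable_sum)
qed

text \<open>The set is the image of the interior under the homothety of ratio \<open>t\<close>
  centred at \<open>x\<close>. Convexity keeps it in the cell even when \<open>x\<close> lies on the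
  boundary, and the null frontier of a convex set lets the interior carry the full volume.\<close>

lemma peak_set_properties:
  fixes I :: "(real ^ 'd) set"
  assumes I: "convex I" "bounded I" "I \<in> sets borel" "measure lborel I > 0"
    and x: "x \<in> closure I" and t: "0 < t" "t \<le> 1"
  shows "open (peak_set t I x)"
    and "bounded (peak_set t I x)"
    and "measure lborel (peak_set t I x) = t ^ CARD('d) * measure lborel I"
    and "peak_set t I x \<subseteq> I"
proof -
  have eq: "peak_set t I x = (\<lambda>y. t *\<^sub>R y + (1 - t) *\<^sub>R x) ` interior I"
    unfolding peak_set_def by (simp add: add.commute)
  have "peak_set t I x = (+) ((1 - t) *\<^sub>R x) ` ((*\<^sub>R) t ` interior I)"
    unfolding peak_set_def by (simp add: image_image)
  then show op: "open (peak_set t I x)"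
    using t by (simp add: open_translation open_scaling)
  show sub: "peak_set t I x \<subseteq> I"
  proof
    fix z assume "z \<in> peak_set t I x"
    then obtain y where y: "y \<in> interior I" "z = (1 - t) *\<^sub>R x + t *\<^sub>R y"
      by (auto simp: peak_set_def)
    have "x - t *\<^sub>R (x - y) \<in> interior I"
      using I(1) y(1) x t by (rule mem_interior_closure_convex_shrink)
    moreover have "x - t *\<^sub>R (x - y) = z" by (simp add: y(2) algebra_simps)
    ultimately show "z \<in> I" using interior_subset by auto
  qed
  show "bounded (peak_set t I x)" using I(2) sub by (rule bounded_subset)
  have "measure lborel (peak_set t I x) = measure lebesgue (peak_set t I x)"
    using op by (simp add: measure_completion)
  also have "\<dots> = t ^ CARD('d) * measure lebesgue (interior I)"
    using t measure_lebesgue_affine[of t "(1 - t) *\<^sub>R x" "interior I"] by (simp add: eq)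
  also have "measure lebesgue (interior I) = measure lebesgue I"
    using I by (intro measure_interior negligible_convex_frontier)
  also have "\<dots> = measure lborel I" using I(3) by (simp add: measure_completion)
  finally show "measure lborel (peak_set t I x) = t ^ CARD('d) * measure lborel I" .
qed

text \<open>The almost everywhere bounds on single cells combine into a global one because there are
  only countably many cells. On the peak cell the bound comes from the maximality of
  \<open>\<bar>g x\<bar>\<close> over the closure.\<close>

lemma Linf_norm_le_peak:
  assumes f: "f \<in> borel_measurable borel"
    and \<I>: "countable \<I>" "\<Union>\<I> = UNIV" and I_borel: "I \<in> sets borel"
    and peak: "is_peak r \<I> f I g x"
  shows "Linf_norm f \<le> ennreal \<bar>g x\<bar>"
proof -
  have pk: "I \<in> \<I>" "Linf_norm (\<lambda>y. f y * indicator I y) = (SUP J\<in>\<I>. Linf_norm (\<lambda>y. f y * indicator J y))"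
    "\<And>y. y \<in> I \<Longrightarrow> g y = f y" "\<And>y. y \<in> closure I \<Longrightarrow> \<bar>g y\<bar> \<le> \<bar>g x\<bar>"
    using peak by (auto simp: is_peak_def)
  have "Linf_norm (\<lambda>y. f y * indicator I y) \<le> ennreal \<bar>g x\<bar>"
    unfolding Linf_norm_def
  proof (rule esssup_I)
    show "(\<lambda>y. ennreal \<bar>f y * indicator I y\<bar>) \<in> borel_measurable lborel"
      using f I_borel by simp
    show "AE y in lborel. ennreal \<bar>f y * indicator I y\<bar> \<le> ennreal \<bar>g x\<bar>"
    proof (rule AE_I2)
      fix y
      have "\<bar>f y * indicator I y\<bar> \<le> \<bar>g x\<bar>"
        using pk(3)[of y] pk(4)[of y] closure_subset[of I] by (auto simp: indicator_def)
      then show "ennreal \<bar>f y * indicator I y\<bar> \<le> ennreal \<bar>g x\<bar>" by (rule ennreal_leI)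
    qed
  qed
  then have sup_le: "Linf_norm (\<lambda>y. f y * indicator J y) \<le> ennreal \<bar>g x\<bar>" if "J \<in> \<I>" for J
    using that unfolding pk(2) by (meson SUP_upper order_trans)
  have "AE y in lborel. ennreal \<bar>f y * indicator J y\<bar> \<le> ennreal \<bar>g x\<bar>" if "J \<in> \<I>" for J
    using esssup_AE
  proof (rule eventually_mono)
    fix y assume "ennreal \<bar>f y * indicator J y\<bar> \<le> esssup lborel (\<lambda>y. ennreal \<bar>f y * indicator J y\<bar>)"
    then show "ennreal \<bar>f y * indicator J y\<bar> \<le> ennreal \<bar>g x\<bar>"
      using sup_le[OF that] unfolding Linf_norm_def by (rule order_trans)
  qed
  then have "AE y in lborel. \<forall>J\<in>\<I>. ennreal \<bar>f y * indicator J y\<bar> \<le> ennreal \<bar>g x\<bar>"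
    using \<I>(1) by (simp add: AE_ball_countable)
  then have "AE y in lborel. ennreal \<bar>f y\<bar> \<le> ennreal \<bar>g x\<bar>"
  proof (rule eventually_mono)
    fix y assume y: "\<forall>J\<in>\<I>. ennreal \<bar>f y * indicator J y\<bar> \<le> ennreal \<bar>g x\<bar>"
    obtain J where "J \<in> \<I>" "y \<in> J" using \<I>(2) by blast
    then show "ennreal \<bar>f y\<bar> \<le> ennreal \<bar>g x\<bar>" using y by force
  qed
  then show ?thesis unfolding Linf_norm_def using f by (intro esssup_I) auto
qed

text \<open>Each point of the box is \<open>x + t (y - x)\<close> with \<open>y\<close> in the cell,
  and \<open>\<bar>g\<bar>\<close> on the segment from \<open>x\<close> to \<open>y\<close> is
  maximal at \<open>x\<close>, so the one-variable decay applies. Multiplying by the sign of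
  \<open>g x\<close> gives a pointwise lower bound, which can be integrated without loss by
  cancellation.\<close>

lemma integral_peak_set_ge:
  fixes I :: "(real ^ 'd) set"
  assumes r: "r \<ge> 1" and f: "integrable lborel f"
    and I: "convex I" "bounded I" "I \<in> sets borel" "measure lborel I > 0"
    and peak: "is_peak r \<I> f I g x" and t: "0 < t" "t \<le> 1 / (real r)\<^sup>2"
  shows "(1 - 2 * (real r)\<^sup>2 * t) * \<bar>g x\<bar> * measure lborel (peak_set t I x)
    \<le> \<bar>LINT y:peak_set t I x|lborel. f y\<bar>"
proof -
  have pk: "g \<in> rat_polys r" "\<And>y. y \<in> I \<Longrightarrow> g y = f y" "x \<in> closure I"
    "\<And>y. y \<in> closure I \<Longrightarrow> \<bar>g y\<bar> \<le> \<bar>g x\<bar>"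
    using peak by (auto simp: is_peak_def)
  have "(real r)\<^sup>2 \<ge> 1" using r by simp
  then have "1 / (real r)\<^sup>2 \<le> 1" by (subst divide_le_eq_1_pos) linarith+
  then have t1: "t \<le> 1" using t by linarith
  define C where "C = peak_set t I x"
  note C = peak_set_properties[OF I pk(3) t(1) t1, folded C_def]
  define c where "c = (1 - 2 * (real r)\<^sup>2 * t) * \<bar>g x\<bar>"
  have lower: "c \<le> sgn (g x) * f z" if z: "z \<in> C" for z
  proof -
    obtain y where y: "y \<in> interior I" "z = (1 - t) *\<^sub>R x + t *\<^sub>R y"
      using z by (auto simp: C_def peak_set_def)
    obtain q :: "real poly" where q: "degree q \<le> r" "\<And>s. poly q s = g (x + s *\<^sub>R (y - x))"
      using rat_polys_along_line[OF pk(1)] by blast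
    have yc: "y \<in> closure I" using y(1) interior_subset closure_subset by blast
    have "\<bar>poly q s\<bar> \<le> \<bar>poly q 0\<bar>" if "0 \<le> s" "s \<le> 1" for s
    proof -
      have "(1 - s) *\<^sub>R x + s *\<^sub>R y \<in> closure I"
        using convex_closure[OF I(1)] pk(3) yc that by (intro convexD_alt)
      moreover have "(1 - s) *\<^sub>R x + s *\<^sub>R y = x + s *\<^sub>R (y - x)" by (simp add: algebra_simps)
      ultimately show ?thesis using pk(4) by (simp add: q(2))
    qed
    then have "(1 - 2 * (real r)\<^sup>2 * t) * \<bar>poly q 0\<bar> \<le> sgn (poly q 0) * poly q t"
      using r q(1) t by (intro poly_endpoint_decay) auto
    moreover have "x + t *\<^sub>R (y - x) = z" by (simp add: y(2) algebra_simps)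
    moreover have "g z = f z" using z C(4) pk(2) by blast
    ultimately show ?thesis by (simp add: q(2) c_def)
  qed
  have C_sets: "C \<in> sets lborel" using C(1) by simp
  have fin: "emeasure lborel C < \<infinity>" using C(2) by (rule emeasure_bounded_finite)
  have fC: "set_integrable lborel C f"
    using integrable_mult_indicator[OF C_sets f] by (simp add: set_integrable_def)
  have "c * measure lborel C = (LINT z:C|lborel. c)"
    using C_sets fin by (simp add: set_integral_const)
  also have "\<dots> \<le> (LINT z:C|lborel. sgn (g x) * f z)"
    using lower fC C_sets fin
    by (intro set_integral_mono set_integrable_mult_right) (auto simp: set_integrable_def)
  also have "\<dots> = sgn (g x) * (LINT z:C|lborel. f z)" by simp
  also have "\<dots> \<le> \<bar>sgn (g x) * (LINT z:C|lborel. f z)\<bar>" by (rule abs_ge_self)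
  also have "\<dots> \<le> 1 * \<bar>LINT z:C|lborel. f z\<bar>"
    unfolding abs_mult by (intro mult_right_mono) (auto simp: sgn_real_def)
  finally show ?thesis by (simp add: c_def C_def)
qed

lemma powr_inverse_power: "x > 0 \<Longrightarrow> (x ^ Suc k) powr (1 / (real k + 1)) = x" for x :: real
  by (simp only: powr_realpow[symmetric] powr_powr) (simp add: add.commute)

text \<open>At the bandwidth of the theorem both regimes of \<open>gamma_fun\<close> compare as \<open>1/2\<close> against at most
  \<open>1/4\<close>.\<close>

lemma theta_bandwidth:
  assumes r: "r \<ge> 1" and d: "d \<ge> 1" and h0: "h0 > 0"
    and h: "h = (1 - 1 / sqrt 2) ^ (d + 1) / (2 * real r ^ 2) ^ d * h0"
  shows "theta r d h0 h = (1 - 1 / sqrt 2) / (2 * real r ^ 2)"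
proof -
  define \<kappa> :: real where "\<kappa> = 1 - 1 / sqrt 2"
  define a :: real where "a = 2 * real r ^ 2"
  define b where "b = 1 / (real d + 1)"
  have \<kappa>: "\<kappa> > 0" by (simp add: \<kappa>_def)
  have a: "a > 0" using r by (simp add: a_def)
  have u: "h / h0 = \<kappa> ^ Suc d / a ^ d" using h0 by (simp add: h \<kappa>_def a_def)
  have "a powr (real d / (real d + 1)) = (a ^ d) powr b"
    using a by (simp add: powr_realpow[symmetric] powr_powr b_def)
  then have "a powr (real d / (real d + 1)) * (h / h0) powr b = (a ^ d) powr b * (h / h0) powr b"
    by (simp only:)
  also have "\<dots> = (a ^ d * (h / h0)) powr b"
    by (rule powr_mult[symmetric])
  also have "a ^ d * (h / h0) = \<kappa> ^ Suc d" using a by (simp add: u)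
  also have "(\<kappa> ^ Suc d) powr b = \<kappa>" unfolding b_def using \<kappa> by (rule powr_inverse_power)
  \<comment> \<open>\<open>\<kappa>\<close> is chosen so that
    \<open>1 - \<kappa> = 1 / sqrt 2\<close>, whose square is the \<open>1/2\<close>; the exponent
    \<open>d + 1\<close> in \<open>h\<close> exists to undo the root of order
    \<open>d + 1\<close>.\<close>
  finally have high: "(max 0 (1 - a powr (real d / (real d + 1)) * (h / h0) powr b))\<^sup>2 = 1 / 2"
    by (simp add: \<kappa>_def power_divide)
  have "gamma_low r d (h / h0) \<le> 1 / (2 * (real d + 1)) * 1"
    unfolding gamma_low_def by (intro mult_left_mono) auto
  also have "\<dots> \<le> 1 / 4" using d by (simp add: field_simps)
  finally have "gamma_low r d (h / h0) < 1 / 2" by simp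
  then have "gamma_fun r d (h / h0) \<noteq> gamma_low r d (h / h0)"
    using high unfolding gamma_fun_def a_def b_def by simp
  then have "theta r d h0 h = (h / (a * h0)) powr b"
    by (simp add: theta_def a_def b_def)
  also have "h / (a * h0) = (\<kappa> / a) ^ Suc d"
    using u a h0 by (simp add: field_simps power_divide)
  also have "\<dots> powr b = \<kappa> / a"
    unfolding b_def using \<kappa> a by (intro powr_inverse_power) simp
  finally show ?thesis by (simp add: \<kappa>_def a_def)
qed

section \<open>Uniform deviations over boxes\<close>

text \<open>If the set has a smallest point \<open>s\<close> and a largest point \<open>t\<close>,
  its mass is at most \<open>cdf M t - cdf M s\<close>, as \<open>s\<close> is no atom. It can be
  unbounded (for instance when \<open>a \<le> 0\<close>), so this is done for compact truncations,
  which then exhaust it.\<close>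

lemma (in real_distribution) measure_cdf_between_le:
  assumes atomless: "\<And>t. measure M {t} = 0" and "a \<le> b"
  shows "measure M {t. a \<le> cdf M t \<and> cdf M t \<le> b} \<le> b - a"
proof -
  interpret finite_borel_measure M by (rule finite_borel_measure_M)
  define A where "A = {t. a \<le> cdf M t \<and> cdf M t \<le> b}"
  have "continuous_on UNIV (cdf M)"
    using isCont_cdf atomless by (simp add: continuous_at_imp_continuous_on)
  then have closed: "closed A"
    unfolding A_def by (intro closed_Collect_conj closed_Collect_le) auto
  have bound: "measure M (A \<inter> {- real m..real m}) \<le> b - a" for m
  proof (cases "A \<inter> {- real m..real m} = {}")
    case False
    let ?K = "A \<inter> {- real m..real m}"
    have K: "compact ?K" using closed by (intro closed_Int_compact compact_Icc)
    obtain s where s: "s \<in> ?K" "\<forall>x\<in>?K. s \<le> x"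
      using compact_attains_inf[OF K False] by blast
    obtain t where t: "t \<in> ?K" "\<forall>x\<in>?K. x \<le> t"
      using compact_attains_sup[OF K False] by blast
    have "?K \<subseteq> {s} \<union> {s<..t}"
    proof
      fix x assume "x \<in> ?K"
      then have "s \<le> x" "x \<le> t" using s(2) t(2) by blast+
      then show "x \<in> {s} \<union> {s<..t}" by auto
    qed
    then have "measure M ?K \<le> measure M ({s} \<union> {s<..t})"
      by (intro finite_measure_mono) auto
    also have "\<dots> \<le> measure M {s} + measure M {s<..t}"
      by (intro measure_Un_le) auto
    also have "\<dots> \<le> cdf M t - cdf M s"
    proof (cases "s = t")
      case False
      then have "s < t" using s(1) t(2) by force
      then show ?thesis using cdf_diff_eq[of s t] by (simp add: atomless)
    qed (simp add: atomless)
    also have "\<dots> \<le> b - a" using s(1) t(1) by (auto simp: A_def)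
    finally show ?thesis .
  qed (use assms in simp)
  have "(\<lambda>m. measure M (A \<inter> {- real m..real m})) \<longlonglongrightarrow> measure M (\<Union>m. A \<inter> {- real m..real m})"
    using closed by (intro finite_Lim_measure_incseq) (auto simp: incseq_def)
  moreover have "(\<Union>m. A \<inter> {- real m..real m}) = A"
  proof safe
    fix x assume "x \<in> A"
    obtain m :: nat where "\<bar>x\<bar> \<le> real m" using real_arch_simple by blast
    then show "x \<in> (\<Union>m. A \<inter> {- real m..real m})" using \<open>x \<in> A\<close> by (intro UN_I[of m]) auto
  qed
  ultimately have "(\<lambda>m. measure M (A \<inter> {- real m..real m})) \<longlonglongrightarrow> measure M A" by simp
  then have "measure M A \<le> b - a"
    using bound by (intro LIMSEQ_le_const2) auto
  then show ?thesis by (simp add: A_def)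
qed

text \<open>The brackets are the boxes whose sides are cut out by multiples of \<open>1/K\<close> in the scale of the
  marginal distribution functions; this replaces the combinatorial (VC) argument.\<close>

lemma interval_products_bracketing:
  fixes Q :: "(real ^ 'd) measure" and K :: nat
  assumes Q: "prob_space Q" and sets_Q: "sets Q = sets borel"
    and atomless: "\<And>i t. measure Q {x. x $ i = t} = 0" and K: "K \<ge> 1"
  obtains Ain Aout :: "('d \<Rightarrow> nat \<times> nat) \<Rightarrow> (real ^ 'd) set" where
    "\<And>\<kappa>. Ain \<kappa> \<in> sets borel" and "\<And>\<kappa>. Aout \<kappa> \<in> sets borel" and
    "\<And>\<kappa>. measure Q (Aout \<kappa> - Ain \<kappa>) \<le> 2 * real CARD('d) / real K" and
    "\<And>C. C \<in> interval_products \<Longrightarrow> C \<noteq> {} \<Longrightarrow>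
       \<exists>\<kappa>\<in>PiE UNIV (\<lambda>_. {0..K} \<times> {0..K}). Ain \<kappa> \<subseteq> C \<and> C \<subseteq> Aout \<kappa>"
proof -
  interpret Q: prob_space Q by (rule Q)
  have [measurable_cong]: "sets Q = sets borel" by (rule sets_Q)
  have space_Q: "space Q = UNIV" using sets_eq_imp_space_eq[OF sets_Q] by simp
  define D where "D i = distr Q borel (\<lambda>x. x $ i)" for i
  have meas_nth [measurable]: "(\<lambda>x. x $ i) \<in> borel_measurable Q" for i
    by (simp add: measurable_cong_sets[OF sets_Q refl])
  have D: "real_distribution (D i)" for i
    unfolding D_def by (rule Q.real_distribution_distr) simp
  have D_at: "measure (D i) {t} = 0" for i t
    unfolding D_def using atomless[of i t] by (simp add: measure_distr space_Q vimage_def)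
  define F where "F i = cdf (D i)" for i
  interpret D: real_distribution "D i" for i by (rule D)
  have mono: "F i s \<le> F i t" if "s \<le> t" for i s t
    unfolding F_def using that
    by (rule finite_borel_measure.cdf_nondecreasing[OF D.finite_borel_measure_M])
  have F01: "0 \<le> F i t" "F i t \<le> 1" for i t
    unfolding F_def by (simp_all add: cdf_def)
  have [measurable]: "F i \<in> borel_measurable borel" for i
    using mono by (intro borel_measurable_mono) (auto simp: mono_def)
  \<comment> \<open>In the scale \<open>K F\<close> of a marginal distribution function, every strip
    of unit width has mass at most \<open>1/K\<close>.\<close>
  have strip: "measure Q {x. u \<le> real K * F i (x $ i) \<and> real K * F i (x $ i) \<le> u + 1} \<le> 1 / real K"
    for i u
  proof -
    have [measurable]: "cdf (distr Q borel (\<lambda>x. x $ i)) \<in> borel_measurable borel"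
      using \<open>F i \<in> borel_measurable borel\<close> by (simp add: F_def D_def)
    have "measure Q {x. u \<le> real K * F i (x $ i) \<and> real K * F i (x $ i) \<le> u + 1}
        = measure (D i) {t. u / real K \<le> cdf (D i) t \<and> cdf (D i) t \<le> (u + 1) / real K}"
      unfolding D_def using K
      by (subst measure_distr) (auto simp: space_Q F_def D_def field_simps vimage_def)
    also have "\<dots> \<le> (u + 1) / real K - u / real K"
      using D_at by (intro D.measure_cdf_between_le) (auto simp: divide_right_mono)
    finally show ?thesis by (simp add: diff_divide_distrib[symmetric])
  qed
  \<comment> \<open>A code stores, per coordinate, the rounded-down ends of the range of
    \<open>K F\<close> over the side. The shifts by 1 absorb the rounding: inwards at the lower end
    here, outwards at the upper end in \<open>Aout\<close>.\<close>
  define Ain where "Ain \<kappa> = {x. \<forall>i. real (fst (\<kappa> i)) + 1 < real K * F i (x $ i) \<and>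
    real K * F i (x $ i) < real (snd (\<kappa> i))}" for \<kappa> :: "'d \<Rightarrow> nat \<times> nat"
  define Aout where "Aout \<kappa> = {x. \<forall>i. real (fst (\<kappa> i)) \<le> real K * F i (x $ i) \<and>
    real K * F i (x $ i) \<le> real (snd (\<kappa> i)) + 1}" for \<kappa> :: "'d \<Rightarrow> nat \<times> nat"
  show thesis
  proof (rule that)
    fix \<kappa> :: "'d \<Rightarrow> nat \<times> nat"
    show m1: "Ain \<kappa> \<in> sets borel" unfolding Ain_def by measurable
    show m2: "Aout \<kappa> \<in> sets borel" unfolding Aout_def by measurable
    define S where "S i u = {x. u \<le> real K * F i (x $ i) \<and> real K * F i (x $ i) \<le> u + 1}" for i u
    have S [measurable]: "S i u \<in> sets Q" for i u unfolding S_def sets_Q by measurable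
    \<comment> \<open>A point of the outer but not of the inner box has some coordinate in one of
      two unit strips, which makes \<open>2 d\<close> strips in all.\<close>
    have "Aout \<kappa> - Ain \<kappa> \<subseteq> (\<Union>i. S i (real (fst (\<kappa> i))) \<union> S i (real (snd (\<kappa> i))))"
      by (auto simp: Aout_def Ain_def S_def not_less)
    then have "measure Q (Aout \<kappa> - Ain \<kappa>)
        \<le> measure Q (\<Union>i. S i (real (fst (\<kappa> i))) \<union> S i (real (snd (\<kappa> i))))"
      by (intro Q.finite_measure_mono) auto
    also have "\<dots> \<le> (\<Sum>i\<in>UNIV. measure Q (S i (real (fst (\<kappa> i))) \<union> S i (real (snd (\<kappa> i)))))"
      by (intro Q.finite_measure_subadditive_finite) auto
    also have "\<dots> \<le> (\<Sum>i\<in>(UNIV :: 'd set). 1 / real K + 1 / real K)"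
    proof (rule sum_mono)
      fix i
      have "measure Q (S i (real (fst (\<kappa> i))) \<union> S i (real (snd (\<kappa> i))))
          \<le> measure Q (S i (real (fst (\<kappa> i)))) + measure Q (S i (real (snd (\<kappa> i))))"
        by (intro measure_Un_le) auto
      also have "\<dots> \<le> 1 / real K + 1 / real K"
        unfolding S_def by (intro add_mono strip)
      finally show "measure Q (S i (real (fst (\<kappa> i))) \<union> S i (real (snd (\<kappa> i)))) \<le> 1 / real K + 1 / real K" .
    qed
    finally show "measure Q (Aout \<kappa> - Ain \<kappa>) \<le> 2 * real CARD('d) / real K"
      by (simp add: field_simps)
  next
    fix C :: "(real ^ 'd) set" assume C: "C \<in> interval_products" "C \<noteq> {}"
    obtain J :: "'d \<Rightarrow> real set" where J: "\<And>i. is_interval (J i)" "C = {x. \<forall>i. x $ i \<in> J i}"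
      using C(1) by (auto simp: interval_products_def)
    have Jne: "J i \<noteq> {}" for i using C(2) J(2) by auto
    have bdd: "bdd_below (F i ` J i)" "bdd_above (F i ` J i)" for i
      using F01 by (auto intro!: bdd_belowI[of _ 0] bdd_aboveI[of _ 1])
    define lo where "lo i = real K * (INF s\<in>J i. F i s)" for i
    define hi where "hi i = real K * (SUP s\<in>J i. F i s)" for i
    have lo_le: "lo i \<le> real K * F i s" and hi_ge: "real K * F i s \<le> hi i" if "s \<in> J i" for i s
      unfolding lo_def hi_def using that bdd[of i]
      by (auto intro!: mult_left_mono cINF_lower cSUP_upper)
    have lo0: "0 \<le> lo i" for i
      unfolding lo_def using Jne F01 by (intro mult_nonneg_nonneg cINF_greatest) auto
    have hi1: "hi i \<le> real K * 1" for i
      unfolding hi_def using Jne F01 by (intro mult_left_mono cSUP_least) auto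
    have lohi: "lo i \<le> hi i" for i
      using Jne[of i] lo_le hi_ge by (meson ex_in_conv order_trans)
    \<comment> \<open>The upper end can equal \<open>K\<close>, so the codes range over
      \<open>{0..K}\<close> with \<open>K\<close> included: \<open>(K + 1)^2\<close> pairs per
      coordinate.\<close>
    define \<kappa> where "\<kappa> i = (nat \<lfloor>lo i\<rfloor>, nat \<lfloor>hi i\<rfloor>)" for i
    have "nat \<lfloor>lo i\<rfloor> \<le> K" "nat \<lfloor>hi i\<rfloor> \<le> K" for i
      using lo0[of i] hi1[of i] lohi[of i] by (auto simp: nat_le_iff floor_le_iff)
    then have "\<kappa> \<in> PiE UNIV (\<lambda>_. {0..K} \<times> {0..K})" by (auto simp: \<kappa>_def)
    moreover have fl: "real (nat \<lfloor>lo i\<rfloor>) \<le> lo i" "lo i < real (nat \<lfloor>lo i\<rfloor>) + 1"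
      "real (nat \<lfloor>hi i\<rfloor>) \<le> hi i" "hi i < real (nat \<lfloor>hi i\<rfloor>) + 1" for i
      using lo0[of i] lohi[of i] by (auto simp: of_nat_nat)
    have "Ain \<kappa> \<subseteq> C"
    proof
      fix x assume x: "x \<in> Ain \<kappa>"
      have "x $ i \<in> J i" for i
      proof -
        have x': "lo i < real K * F i (x $ i)" "real K * F i (x $ i) < hi i"
        proof -
          have "real (nat \<lfloor>lo i\<rfloor>) + 1 < real K * F i (x $ i)" "real K * F i (x $ i) < real (nat \<lfloor>hi i\<rfloor>)"
            using x by (simp_all add: Ain_def \<kappa>_def)
          then show "lo i < real K * F i (x $ i)" "real K * F i (x $ i) < hi i"
            using fl(2,3)[of i] by linarith+
        qed
        \<comment> \<open>The strict inequalities matter because \<open>F\<close> may have flat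
          pieces: they provide points of the side with strictly smaller and strictly larger
          \<open>F\<close>, hence on either side of the coordinate, and an interval contains what
          lies between.\<close>
        have "(INF s\<in>J i. F i s) < F i (x $ i)" "F i (x $ i) < (SUP s\<in>J i. F i s)"
          using x' K by (auto simp: lo_def hi_def)
        then obtain s t where st: "s \<in> J i" "t \<in> J i" "F i s < F i (x $ i)" "F i (x $ i) < F i t"
          using Jne bdd by (auto simp: cINF_less_iff less_cSUP_iff)
        then have "s \<le> x $ i" "x $ i \<le> t" using mono by (meson linear not_less)+
        then show ?thesis using J(1)[of i] st(1,2) by (meson mem_is_interval_1_I)
      qed
      then show "x \<in> C" by (simp add: J(2))
    qed
    moreover have "C \<subseteq> Aout \<kappa>"
    proof
      fix x assume "x \<in> C"
      then have "lo i \<le> real K * F i (x $ i)" "real K * F i (x $ i) \<le> hi i" for i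
        using lo_le hi_ge by (auto simp: J(2))
      then show "x \<in> Aout \<kappa>" using fl
        unfolding Aout_def \<kappa>_def fst_conv snd_conv by (blast intro: order_trans less_imp_le)
    qed
    ultimately show "\<exists>\<kappa>\<in>PiE UNIV (\<lambda>_. {0..K} \<times> {0..K}). Ain \<kappa> \<subseteq> C \<and> C \<subseteq> Aout \<kappa>" by blast
  qed
qed

section \<open>Exponential moments of counts\<close>

lemma exp_le_quadratic:
  fixes x :: real
  assumes "\<bar>x\<bar> \<le> 1"
  shows "exp x \<le> 1 + x + x\<^sup>2"
proof (cases "x \<ge> 0")
  case True
  then show ?thesis using assms exp_bound[of x] by simp
next
  case False
  \<comment> \<open>The product is \<open>1 - x^3\<close>.\<close>
  have "1 \<le> (1 + x + x\<^sup>2) * (1 - x)"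
    using False by (simp add: algebra_simps power2_eq_square mult_nonneg_nonpos2 mult_nonneg_nonpos)
  also have "\<dots> \<le> (1 + x + x\<^sup>2) * exp (- x)"
    using exp_ge_add_one_self[of "- x"] False assms by (intro mult_left_mono) (auto simp: add_nonneg_nonneg)
  finally show ?thesis by (simp add: exp_minus field_simps)
qed

context prob_space
begin

text \<open>Independence factorises the exponential moment; each Bernoulli factor is bounded through
  \<open>exp t - 1 \<le> t + t^2\<close> and \<open>1 + z \<le> exp z\<close>. The mean count plays
  the role of the variance, so sets of small mass get small fluctuations.\<close>

lemma nn_integral_exp_centred_count_le:
  fixes X :: "nat \<Rightarrow> 'a \<Rightarrow> 'b :: topological_space" and q :: "nat \<Rightarrow> real"
  assumes indep: "indep_vars (\<lambda>_. borel) X {..<n}" and A: "A \<in> sets borel" and t: "\<bar>t\<bar> \<le> 1"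
    and q: "\<And>i. i < n \<Longrightarrow> q i = prob (X i -` A \<inter> space M)"
  shows "(\<integral>\<^sup>+\<omega>. ennreal (exp (t * ((\<Sum>i<n. indicator A (X i \<omega>)) - (\<Sum>i<n. q i)))) \<partial>M)
    \<le> ennreal (exp (t\<^sup>2 * (\<Sum>i<n. q i)))"
proof -
  note [measurable] = A
  have rv [measurable]: "X i \<in> borel_measurable M" if "i < n" for i
    using indep that unfolding indep_vars_def by auto
  define Y where "Y i \<omega> = ennreal (exp (t * (indicator A (X i \<omega>) - q i)))" for i \<omega>
  have "(\<integral>\<^sup>+\<omega>. ennreal (exp (t * ((\<Sum>i<n. indicator A (X i \<omega>)) - (\<Sum>i<n. q i)))) \<partial>M)
      = (\<integral>\<^sup>+\<omega>. (\<Prod>i<n. Y i \<omega>) \<partial>M)"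
    unfolding Y_def
    by (simp add: prod_ennreal exp_sum[symmetric] sum_subtractf[symmetric] sum_distrib_left)
  also have "\<dots> = (\<Prod>i<n. \<integral>\<^sup>+\<omega>. Y i \<omega> \<partial>M)"
    unfolding Y_def
    by (intro indep_vars_nn_integral indep_vars_compose2[OF indep]) auto
  also have "\<dots> \<le> (\<Prod>i<n. ennreal (exp (t\<^sup>2 * q i)))"
  proof (intro prod_mono_ennreal)
    fix i assume "i \<in> {..<n}"
    then have i: "i < n" by simp
    note rv[OF i, measurable]
    have q01: "0 \<le> q i" "q i \<le> 1" using q[OF i] by auto
    have eq: "Y i \<omega> = ennreal (exp (t - t * q i)) * indicator (X i -` A \<inter> space M) \<omega>
       + ennreal (exp (- t * q i)) * indicator (space M - (X i -` A \<inter> space M)) \<omega>"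
      if "\<omega> \<in> space M" for \<omega>
      using that by (auto simp: Y_def indicator_def algebra_simps)
    have "(\<integral>\<^sup>+\<omega>. Y i \<omega> \<partial>M) = ennreal (exp (t - t * q i)) * emeasure M (X i -` A \<inter> space M)
       + ennreal (exp (- t * q i)) * emeasure M (space M - (X i -` A \<inter> space M))"
      by (subst nn_integral_cong[OF eq]) (auto simp: nn_integral_add nn_integral_cmult)
    also have "\<dots> = ennreal (exp (t - t * q i) * q i + exp (- t * q i) * (1 - q i))"
      using q01 by (simp add: emeasure_eq_measure prob_compl q[OF i] ennreal_mult[symmetric]
          ennreal_plus[symmetric] del: ennreal_plus)
    also have "\<dots> \<le> ennreal (exp (t\<^sup>2 * q i))"
    proof (rule ennreal_leI)
      have "exp (t - t * q i) * q i + exp (- t * q i) * (1 - q i)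
          = exp (- t * q i) * (1 + q i * (exp t - 1))"
        by (simp add: exp_diff exp_minus field_simps)
      also have "\<dots> \<le> exp (- t * q i) * (1 + q i * (t + t\<^sup>2))"
        using exp_le_quadratic[OF t] q01 by (intro mult_left_mono add_left_mono) auto
      also have "\<dots> \<le> exp (- t * q i) * exp (q i * (t + t\<^sup>2))"
        by (intro mult_left_mono exp_ge_add_one_self) auto
      also have "\<dots> = exp (t\<^sup>2 * q i)" by (simp add: exp_add[symmetric] algebra_simps)
      finally show "exp (t - t * q i) * q i + exp (- t * q i) * (1 - q i) \<le> exp (t\<^sup>2 * q i)" .
    qed
    finally show "(\<integral>\<^sup>+\<omega>. Y i \<omega> \<partial>M) \<le> ennreal (exp (t\<^sup>2 * q i))" .
  qed
  also have "\<dots> = ennreal (exp (t\<^sup>2 * (\<Sum>i<n. q i)))"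
    by (simp add: prod_ennreal exp_sum[symmetric] sum_distrib_left)
  finally show ?thesis .
qed

text \<open>\<open>R\<close> is \<open>L\<close> plus the sum of the normalised exponential moments, which suffices because
  \<open>x \<le> L + exp (x - L)\<close>. The parameter \<open>min(1, sqrt (L/s))\<close> is the one that optimises
  Bernstein's inequality.\<close>

lemma uniform_bernstein:
  fixes X :: "nat \<Rightarrow> 'a \<Rightarrow> 'b :: topological_space" and q :: "'j \<Rightarrow> nat \<Rightarrow> real"
  assumes indep: "indep_vars (\<lambda>_. borel) X {..<n}"
    and J: "finite J" "2 * real (card J) \<le> exp L" and L: "L > 0"
    and A: "\<And>j. j \<in> J \<Longrightarrow> A j \<in> sets borel"
    and q: "\<And>i j. j \<in> J \<Longrightarrow> i < n \<Longrightarrow> q j i = prob (X i -` A j \<inter> space M)"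
  obtains R :: "'a \<Rightarrow> real" where "R \<in> borel_measurable M" and "\<And>\<omega>. 0 \<le> R \<omega>"
    and "(\<integral>\<^sup>+\<omega>. ennreal (R \<omega>) \<partial>M) \<le> ennreal (L + 1)"
    and "\<And>\<omega> j. j \<in> J \<Longrightarrow> \<bar>(\<Sum>i<n. indicator (A j) (X i \<omega>)) - (\<Sum>i<n. q j i)\<bar>
      \<le> sqrt ((\<Sum>i<n. q j i) * L) + R \<omega> * sqrt ((\<Sum>i<n. q j i) / L) + R \<omega>"
proof -
  have rv [measurable]: "X i \<in> borel_measurable M" if "i < n" for i
    using indep that unfolding indep_vars_def by auto
  define S where "S j = (\<Sum>i<n. q j i)" for j
  define N where "N j \<omega> = (\<Sum>i<n. indicator (A j) (X i \<omega>) :: real)" for j \<omega>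
  define lam where "lam j = (if S j \<le> L then 1 else sqrt (L / S j))" for j
  \<comment> \<open>The term \<open>- L\<close> makes each mean at most \<open>exp (- L)\<close>.
    There are \<open>2 card J\<close> such variables, so by the assumption on \<open>L\<close> their
    sum has mean at most 1: the \<open>+ 1\<close> in \<open>L + 1\<close>.\<close>
  define E where "E j t \<omega> = exp (t * lam j * (N j \<omega> - S j) - (lam j)\<^sup>2 * S j - L)" for j t \<omega>
  define R where "R \<omega> = L + (\<Sum>j\<in>J. E j 1 \<omega> + E j (- 1) \<omega>)" for \<omega>
  have S0: "0 \<le> S j" if "j \<in> J" for j
    unfolding S_def using q that by (intro sum_nonneg) auto
  have lam: "0 < lam j" "lam j \<le> 1" for j
    using L by (auto simp: lam_def real_sqrt_le_1_iff)
  have N_meas: "N j \<in> borel_measurable M" if "j \<in> J" for j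
    unfolding N_def using A[OF that] by (intro borel_measurable_sum) auto
  have E_meas: "E j t \<in> borel_measurable M" if "j \<in> J" for j t
  proof -
    note N_meas[OF that, measurable]
    show ?thesis unfolding E_def by measurable
  qed
  have E_int: "(\<integral>\<^sup>+\<omega>. ennreal (E j t \<omega>) \<partial>M) \<le> ennreal (exp (- L))" if j: "j \<in> J" and t: "\<bar>t\<bar> = 1" for j t
  proof -
    have t2: "t\<^sup>2 = 1" using t by (metis power2_abs power_one)
    have "(\<integral>\<^sup>+\<omega>. ennreal (E j t \<omega>) \<partial>M) = (\<integral>\<^sup>+\<omega>. ennreal (exp (- (lam j)\<^sup>2 * S j - L)) *
        ennreal (exp (t * lam j * (N j \<omega> - S j))) \<partial>M)"
      unfolding E_def by (simp add: ennreal_mult[symmetric] exp_add[symmetric] algebra_simps)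
    also have "\<dots> = ennreal (exp (- (lam j)\<^sup>2 * S j - L)) * (\<integral>\<^sup>+\<omega>. ennreal (exp (t * lam j * (N j \<omega> - S j))) \<partial>M)"
    proof (rule nn_integral_cmult)
      note N_meas[OF j, measurable]
      show "(\<lambda>\<omega>. ennreal (exp (t * lam j * (N j \<omega> - S j)))) \<in> borel_measurable M" by measurable
    qed
    also have "\<dots> \<le> ennreal (exp (- (lam j)\<^sup>2 * S j - L)) * ennreal (exp ((t * lam j)\<^sup>2 * S j))"
      unfolding N_def S_def using indep A[OF j] q[OF j] t lam[of j]
      by (intro mult_left_mono nn_integral_exp_centred_count_le) (auto simp: abs_mult)
    also have "\<dots> = ennreal (exp (- L))"
      by (simp add: ennreal_mult[symmetric] exp_add[symmetric] power_mult_distrib t2)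
    finally show ?thesis .
  qed
  have E0: "0 \<le> E j t \<omega>" for j t \<omega> by (simp add: E_def)
  have R0: "L \<le> R \<omega>" for \<omega> using E0 by (auto simp: R_def intro!: sum_nonneg add_nonneg_nonneg)
  show thesis
  proof (rule that)
    show "R \<in> borel_measurable M"
      unfolding R_def using E_meas by (intro borel_measurable_add borel_measurable_sum) auto
    show "0 \<le> R \<omega>" for \<omega> using R0[of \<omega>] L by linarith
    have "(\<integral>\<^sup>+\<omega>. ennreal (R \<omega>) \<partial>M) = (\<integral>\<^sup>+\<omega>. ennreal L + (\<Sum>j\<in>J. ennreal (E j 1 \<omega>) + ennreal (E j (- 1) \<omega>)) \<partial>M)"
      unfolding R_def using L E0
      by (simp add: ennreal_plus[symmetric] sum_ennreal sum_nonneg add_nonneg_nonneg del: ennreal_plus)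
    also have "\<dots> = ennreal L + (\<Sum>j\<in>J. (\<integral>\<^sup>+\<omega>. ennreal (E j 1 \<omega>) \<partial>M) + (\<integral>\<^sup>+\<omega>. ennreal (E j (- 1) \<omega>) \<partial>M))"
      using E_meas by (subst nn_integral_add)
        (auto simp: nn_integral_sum nn_integral_add emeasure_space_1 intro!: borel_measurable_sum sum.cong)
    also have "\<dots> \<le> ennreal L + (\<Sum>j\<in>J. ennreal (exp (- L)) + ennreal (exp (- L)))"
      by (intro add_left_mono sum_mono add_mono E_int) auto
    also have "ennreal (exp (- L)) + ennreal (exp (- L)) = ennreal (2 * exp (- L))"
      by (simp flip: ennreal_plus)
    also have "ennreal L + (\<Sum>j\<in>J. ennreal (2 * exp (- L))) = ennreal (L + (\<Sum>j\<in>J. 2 * exp (- L)))"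
      using L by (subst sum_ennreal) (auto simp: sum_nonneg simp flip: ennreal_plus)
    also have "\<dots> \<le> ennreal (L + 1)"
      using J(2) by (intro ennreal_leI) (simp add: exp_minus field_simps)
    finally show "(\<integral>\<^sup>+\<omega>. ennreal (R \<omega>) \<partial>M) \<le> ennreal (L + 1)" .
  next
    fix \<omega> j assume j: "j \<in> J"
    have up: "t * lam j * (N j \<omega> - S j) \<le> (lam j)\<^sup>2 * S j + R \<omega>" if t: "t = 1 \<or> t = - 1" for t
    proof -
      have "t * lam j * (N j \<omega> - S j) - (lam j)\<^sup>2 * S j \<le> L + E j t \<omega>"
        unfolding E_def
        using exp_ge_add_one_self[of "t * lam j * (N j \<omega> - S j) - (lam j)\<^sup>2 * S j - L"] by linarith
      also have "E j t \<omega> \<le> E j 1 \<omega> + E j (- 1) \<omega>"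
        using t E0[of j 1 \<omega>] E0[of j "- 1" \<omega>] by auto
      also have "\<dots> \<le> (\<Sum>j\<in>J. E j 1 \<omega> + E j (- 1) \<omega>)"
        using J(1) j E0 by (intro member_le_sum) auto
      finally show ?thesis by (simp add: R_def)
    qed
    have "lam j * \<bar>N j \<omega> - S j\<bar> \<le> (lam j)\<^sup>2 * S j + R \<omega>"
    proof -
      have "lam j * \<bar>N j \<omega> - S j\<bar> = \<bar>lam j * (N j \<omega> - S j)\<bar>"
        using lam(1)[of j] by (simp add: abs_mult)
      then show ?thesis using up[of 1] up[of "- 1"] by (simp add: abs_le_iff)
    qed
    \<comment> \<open>After division by \<open>lam\<close> the two regimes remain:
      \<open>lam j = 1\<close> if \<open>S j \<le> L\<close> (which includes
      \<open>S j = 0\<close>), and otherwise \<open>lam j * S j = sqrt (S j * L)\<close> and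
      \<open>1 / lam j = sqrt (S j / L)\<close>. The final bound is valid in both.\<close>
    then have "\<bar>N j \<omega> - S j\<bar> \<le> lam j * S j + R \<omega> / lam j"
      using lam[of j] by (simp add: field_simps power2_eq_square)
    also have "lam j * S j \<le> sqrt (S j * L)"
    proof (cases "S j \<le> L")
      case True
      then have "sqrt (S j * S j) \<le> sqrt (S j * L)"
        using S0[OF j] by (intro real_sqrt_le_mono mult_left_mono) auto
      then show ?thesis using True S0[OF j] by (simp add: lam_def)
    next
      case False
      then have "S j > 0" using L by simp
      then show ?thesis using False
        by (simp add: lam_def real_sqrt_divide real_sqrt_mult real_div_sqrt field_simps)
    qed
    also have "R \<omega> / lam j \<le> R \<omega> * sqrt (S j / L) + R \<omega>"
    proof (cases "S j \<le> L")
      case True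
      then show ?thesis using R0[of \<omega>] L S0[OF j] by (simp add: lam_def)
    next
      case False
      then show ?thesis using R0[of \<omega>] L S0[OF j] by (simp add: lam_def real_sqrt_divide)
    qed
    finally show "\<bar>(\<Sum>i<n. indicator (A j) (X i \<omega>)) - (\<Sum>i<n. q j i)\<bar>
      \<le> sqrt ((\<Sum>i<n. q j i) * L) + R \<omega> * sqrt ((\<Sum>i<n. q j i) / L) + R \<omega>"
      by (simp add: N_def S_def)
  qed
qed

end

section \<open>Deviations over all boxes\<close>

lemma null_sets_coordinate_hyperplane: "{x :: real ^ 'd. x $ i = t} \<in> null_sets lborel"
proof -
  have "negligible {x :: real ^ 'd. x $ i = t}"
    using negligible_standard_hyperplane[of "axis i 1 :: real ^ 'd" t]
    by (simp add: inner_axis' axis_in_Basis_iff inner_commute inner_axis)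
  moreover have "closed {x :: real ^ 'd. x $ i = t}"
    by (intro closed_Collect_eq continuous_intros)
  then have "{x :: real ^ 'd. x $ i = t} \<in> sets lborel" by simp
  ultimately show ?thesis
    by (simp add: negligible_iff_null_sets null_sets_completion_iff)
qed

text \<open>Supplies the condition on \<open>L\<close> in the Bernstein bound: the left side is
  twice the number of brackets. Since \<open>e n\<close> is at least \<open>n + 1\<close> and at
  least 2, the count is at most \<open>(e n)^(2d+2)\<close>, and the exponent is raised to
  \<open>4d + 2\<close> to reach twice \<open>2d + 1\<close>.\<close>

lemma bracket_count_le:
  assumes n: "n \<ge> 1"
  shows "4 * (real n + 1) ^ (2 * d) \<le> exp (2 * (2 * real d + 1) * ln (exp 1 * real n))"
proof -
  define y where "y = exp 1 * real n"
  have e2: "exp 1 \<ge> (2 :: real)" using exp_ge_add_one_self[of 1] by simp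
  have y2: "y \<ge> 2"
    unfolding y_def using mult_mono[OF e2, of 1 "real n"] n by simp
  have "real n + 1 \<le> 2 * real n" using n by simp
  also have "\<dots> \<le> y" unfolding y_def using e2 by (intro mult_right_mono) auto
  finally have "(real n + 1) ^ (2 * d) \<le> y ^ (2 * d)" by (intro power_mono) auto
  moreover have "2 ^ 2 \<le> y ^ 2" using y2 by (intro power_mono) auto
  ultimately have "2 ^ 2 * (real n + 1) ^ (2 * d) \<le> y ^ 2 * y ^ (2 * d)"
    by (intro mult_mono) auto
  then have "4 * (real n + 1) ^ (2 * d) \<le> y ^ (2 * d + 2)"
    by (simp add: power_add power2_eq_square mult.commute mult.left_commute)
  also have "\<dots> \<le> y ^ (4 * d + 2)" using y2 by (intro power_increasing) auto
  also have "\<dots> = exp (real (4 * d + 2) * ln y)"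
    using y2 by (subst exp_of_nat_mult) simp
  also have "real (4 * d + 2) = 2 * (2 * real d + 1)" by simp
  finally show ?thesis by (simp add: y_def)
qed

text \<open>The variable \<open>R\<close> is the same for all boxes, and only the deterministic
  \<open>s\<close>, the mass of an outer bracket, depends on the box. Its two upper bounds, 1 and
  the mass of the box plus \<open>e\<close>, lead to the two terms of the minimum; \<open>e\<close>
  is the bracketing gap at resolution \<open>1/n\<close>.\<close>

lemma (in prob_space) empirical_deviation_interval_products:
  fixes X :: "nat \<Rightarrow> 'a \<Rightarrow> real ^ 'd" and p :: "nat \<Rightarrow> real ^ 'd \<Rightarrow> real" and n :: nat
  defines "pstar \<equiv> \<lambda>x. (1 / real n) * (\<Sum>i<n. p i x)"
    and "L \<equiv> 2 * (2 * real CARD('d) + 1) * ln (exp 1 * real n)"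
    and "e \<equiv> 2 * real CARD('d) / real n"
  assumes n: "n \<ge> 1"
    and indep: "indep_vars (\<lambda>_. borel) X {..<n}"
    and dens: "\<And>i. i < n \<Longrightarrow> distributed M lborel (X i) (\<lambda>x. ennreal (p i x))"
    and nonneg: "\<And>i x. i < n \<Longrightarrow> 0 \<le> p i x"
  obtains R :: "'a \<Rightarrow> real" where "R \<in> borel_measurable M" and "\<And>\<omega>. 0 \<le> R \<omega>"
    and "(\<integral>\<^sup>+\<omega>. ennreal (R \<omega>) \<partial>M) \<le> ennreal (L + 1)"
    and "\<And>\<omega> C. C \<in> interval_products \<Longrightarrow> C \<in> sets borel \<Longrightarrow> C \<noteq> {} \<Longrightarrow>
      \<exists>s. 0 \<le> s \<and> s \<le> 1 \<and> s \<le> (LINT x:C|lborel. pstar x) + e \<and>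
        \<bar>(\<Sum>i<n. indicator C (X i \<omega>)) / real n - (LINT x:C|lborel. pstar x)\<bar>
          \<le> sqrt (s * L / real n) * (1 + R \<omega> / L) + R \<omega> / real n + e"
proof -
  have p_meas: "p i \<in> borel_measurable borel" if "i < n" for i
    using distributed_real_measurable[OF _ dens[OF that]] nonneg[OF that] by simp
  have pstar_meas: "pstar \<in> borel_measurable borel"
    unfolding pstar_def using p_meas by (intro borel_measurable_times borel_measurable_sum) auto
  have pstar0: "0 \<le> pstar x" for x
    unfolding pstar_def using nonneg by (intro mult_nonneg_nonneg sum_nonneg) auto
  \<comment> \<open>The average of the laws of the observations: the sum over \<open>i\<close> of
    the probabilities of \<open>A\<close> is \<open>n\<close> times its
    \<open>Q\<close>-mass.\<close>
  define Q where "Q = density lborel (\<lambda>x. ennreal (pstar x))"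
  have sets_Q: "sets Q = sets borel" by (simp add: Q_def)
  have Q_em: "emeasure Q A = ennreal (1 / real n) * (\<Sum>i<n. emeasure M (X i -` A \<inter> space M))"
    if A: "A \<in> sets borel" for A
  proof -
    have "emeasure Q A = (\<integral>\<^sup>+x. ennreal (pstar x) * indicator A x \<partial>lborel)"
      unfolding Q_def using A pstar_meas by (subst emeasure_density) auto
    also have "\<dots> = (\<integral>\<^sup>+x. ennreal (1 / real n) * (\<Sum>i<n. ennreal (p i x) * indicator A x) \<partial>lborel)"
    proof (rule nn_integral_cong)
      fix x
      have "ennreal (pstar x) = ennreal (1 / real n) * (\<Sum>i<n. ennreal (p i x))"
      proof -
        have "ennreal (pstar x) = ennreal (1 / real n) * ennreal (\<Sum>i<n. p i x)"
          unfolding pstar_def using nonneg by (intro ennreal_mult sum_nonneg) auto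
        also have "ennreal (\<Sum>i<n. p i x) = (\<Sum>i<n. ennreal (p i x))"
          using nonneg by (intro sum_ennreal[symmetric]) auto
        finally show ?thesis .
      qed
      then show "ennreal (pstar x) * indicator A x
          = ennreal (1 / real n) * (\<Sum>i<n. ennreal (p i x) * indicator A x)"
        by (simp only: sum_distrib_right mult.assoc)
    qed
    also have "\<dots> = ennreal (1 / real n) * (\<integral>\<^sup>+x. (\<Sum>i<n. ennreal (p i x) * indicator A x) \<partial>lborel)"
      using p_meas A by (intro nn_integral_cmult borel_measurable_sum) auto
    also have "(\<integral>\<^sup>+x. (\<Sum>i<n. ennreal (p i x) * indicator A x) \<partial>lborel)
        = (\<Sum>i<n. \<integral>\<^sup>+x. ennreal (p i x) * indicator A x \<partial>lborel)"
      using p_meas A by (intro nn_integral_sum) auto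
    also have "\<dots> = (\<Sum>i<n. emeasure M (X i -` A \<inter> space M))"
      using A distributed_emeasure[OF dens] by simp
    finally show ?thesis .
  qed
  define q where "q A i = prob (X i -` A \<inter> space M)" for A :: "(real ^ 'd) set" and i
  have Q_q: "emeasure Q A = ennreal ((\<Sum>i<n. q A i) / real n)" if "A \<in> sets borel" for A
    unfolding Q_em[OF that] q_def
    by (simp add: emeasure_eq_measure sum_nonneg ennreal_mult[symmetric])
  then have Q_m: "measure Q A = (\<Sum>i<n. q A i) / real n" if "A \<in> sets borel" for A
    using that by (simp add: measure_def q_def sum_nonneg)
  have Q: "prob_space Q"
  proof
    have "emeasure Q UNIV = 1"
      using n Q_q[of UNIV] by (simp add: q_def prob_space)
    then show "emeasure Q (space Q) = 1" by (simp add: Q_def)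
  qed
  interpret Q: prob_space Q by (rule Q)
  have Q_int: "measure Q A = (LINT x:A|lborel. pstar x)" if "A \<in> sets borel" for A
  proof -
    have "measure Q A = enn2real (\<integral>\<^sup>+x. ennreal (pstar x * indicator A x) \<partial>lborel)"
      unfolding measure_def Q_def using that pstar_meas
      by (subst emeasure_density) (auto simp: ennreal_mult'' indicator_def intro!: arg_cong[where f=enn2real] nn_integral_cong)
    also have "\<dots> = (\<integral>x. pstar x * indicator A x \<partial>lborel)"
      using that pstar_meas pstar0 by (subst integral_eq_nn_integral) auto
    finally show ?thesis by (simp add: set_lebesgue_integral_def mult.commute)
  qed
  have atomless: "measure Q {x. x $ i = t} = 0" for i t
  proof -
    have "{x. x $ i = t} \<in> null_sets Q"
      unfolding Q_def using null_sets_coordinate_hyperplane[of i t] pstar_meas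
      by (auto simp: null_sets_density_iff dest: AE_not_in)
    then show ?thesis by (simp add: null_setsD1 measure_def)
  qed
  obtain Ain Aout :: "('d \<Rightarrow> nat \<times> nat) \<Rightarrow> (real ^ 'd) set" where
    A_sets: "\<And>\<kappa>. Ain \<kappa> \<in> sets borel" "\<And>\<kappa>. Aout \<kappa> \<in> sets borel" and
    gap: "\<And>\<kappa>. measure Q (Aout \<kappa> - Ain \<kappa>) \<le> e" and
    bracket: "\<And>C. C \<in> interval_products \<Longrightarrow> C \<noteq> {} \<Longrightarrow>
       \<exists>\<kappa>\<in>PiE UNIV (\<lambda>_. {0..n} \<times> {0..n}). Ain \<kappa> \<subseteq> C \<and> C \<subseteq> Aout \<kappa>"
    using interval_products_bracketing[OF Q sets_Q atomless n] unfolding e_def by metis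
  \<comment> \<open>The boolean selects the outer or the inner box of a code, so that one
    application of the Bernstein bound covers both.\<close>
  define J where "J = (UNIV :: bool set) \<times> PiE (UNIV :: 'd set) (\<lambda>_. {0..n} \<times> {0..n})"
  define A where "A j = (if fst j then Aout (snd j) else Ain (snd j))" for j
  have A_borel: "A j \<in> sets borel" for j using A_sets by (simp add: A_def)
  have J_fin: "finite J" unfolding J_def by (intro finite_cartesian_product finite_PiE) auto
  have "card J = 2 * ((n + 1)\<^sup>2) ^ CARD('d)"
    unfolding J_def by (simp add: card_cartesian_product card_PiE power2_eq_square)
  also have "\<dots> = 2 * (n + 1) ^ (2 * CARD('d))" by (simp only: power_mult)
  finally have "2 * real (card J) = 4 * (real n + 1) ^ (2 * CARD('d))" by (simp add: add.commute)
  then have J_card: "2 * real (card J) \<le> exp L"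
    unfolding L_def using bracket_count_le[OF n] by simp
  have "ln (exp 1 * real n) \<ge> 1" using n by (simp add: ln_mult)
  then have L: "L > 0" unfolding L_def by (intro mult_pos_pos) auto
  obtain R :: "'a \<Rightarrow> real" where R: "R \<in> borel_measurable M" "\<And>\<omega>. 0 \<le> R \<omega>"
    "(\<integral>\<^sup>+\<omega>. ennreal (R \<omega>) \<partial>M) \<le> ennreal (L + 1)"
    and dev: "\<And>\<omega> j. j \<in> J \<Longrightarrow> \<bar>(\<Sum>i<n. indicator (A j) (X i \<omega>)) - (\<Sum>i<n. q (A j) i)\<bar>
      \<le> sqrt ((\<Sum>i<n. q (A j) i) * L) + R \<omega> * sqrt ((\<Sum>i<n. q (A j) i) / L) + R \<omega>"
    by (rule uniform_bernstein[OF indep J_fin J_card L, of A "\<lambda>j. q (A j)"])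
      (rule A_borel, rule q_def, rule that)
  show thesis
  proof (rule that[OF R])
    fix \<omega> and C :: "(real ^ 'd) set"
    assume C: "C \<in> interval_products" "C \<in> sets borel" "C \<noteq> {}"
    obtain \<kappa> where \<kappa>: "\<kappa> \<in> PiE UNIV (\<lambda>_. {0..n} \<times> {0..n})" "Ain \<kappa> \<subseteq> C" "C \<subseteq> Aout \<kappa>"
      using bracket[OF C(1,3)] by blast
    define N where "N B = (\<Sum>i<n. indicator B (X i \<omega>)) / real n" for B
    define s where "s = measure Q (Aout \<kappa>)"
    have N_mono: "N B \<le> N B'" if "B \<subseteq> B'" for B B'
      unfolding N_def using that
      by (intro divide_right_mono sum_mono) (auto simp: indicator_def)
    have Q_mono: "measure Q (Ain \<kappa>) \<le> measure Q C" "measure Q C \<le> s"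
      unfolding s_def using \<kappa> A_sets C(2) by (auto intro!: Q.finite_measure_mono simp: sets_Q)
    have "s = measure Q (Ain \<kappa>) + measure Q (Aout \<kappa> - Ain \<kappa>)"
      unfolding s_def using \<kappa> A_sets by (subst Q.finite_measure_Diff) (auto simp: sets_Q)
    then have s_le: "s \<le> measure Q (Ain \<kappa>) + e" using gap[of \<kappa>] by linarith
    have bound: "\<bar>N B - measure Q B\<bar> \<le> sqrt (s * L / real n) * (1 + R \<omega> / L) + R \<omega> / real n"
      if B_cases: "B = Aout \<kappa> \<or> B = Ain \<kappa>" for B
    proof -
      obtain j where j: "j \<in> J" "B = A j"
      proof
        \<comment> \<open>The flag is the truth value of \<open>B = Aout \<kappa>\<close>, which is
          correct also when the two boxes coincide.\<close>
        show "(B = Aout \<kappa>, \<kappa>) \<in> J" using \<kappa>(1) by (simp add: J_def)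
        show "B = A (B = Aout \<kappa>, \<kappa>)" using B_cases by (auto simp: A_def)
      qed
      have B: "B \<in> sets borel" using B_cases A_sets by auto
      define b where "b = measure Q B"
      have b: "0 \<le> b" "b \<le> s" using B_cases Q_mono by (auto simp: b_def s_def)
      have sum_q: "(\<Sum>i<n. q B i) = real n * b" using Q_m[OF B] n by (simp add: b_def)
      have "N B - b = ((\<Sum>i<n. indicator B (X i \<omega>)) - real n * b) / real n"
        using n by (simp add: N_def diff_divide_distrib)
      then have "\<bar>N B - b\<bar> = \<bar>(\<Sum>i<n. indicator B (X i \<omega>)) - real n * b\<bar> / real n"
        by simp
      also have "\<dots> \<le> (sqrt (real n * b * L) + R \<omega> * sqrt (real n * b / L) + R \<omega>) / real n"
        using dev[OF j(1), of \<omega>] unfolding j(2)[symmetric] sum_q by (intro divide_right_mono) auto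
      also have "\<dots> = sqrt (b * L / real n) * (1 + R \<omega> / L) + R \<omega> / real n"
      proof -
        have "sqrt (real n * b * L) / real n = sqrt (b * L / real n)"
          using n by (simp add: real_sqrt_divide real_sqrt_mult field_simps)
        moreover have "sqrt (real n * b / L) / real n = sqrt (b * L / real n) / L"
          using n L by (simp add: real_sqrt_divide real_sqrt_mult field_simps)
        moreover have "(x + R \<omega> * y + R \<omega>) / real n = x / real n + R \<omega> * (y / real n) + R \<omega> / real n"
          for x y by (simp add: add_divide_distrib)
        moreover have "x + R \<omega> * (x / L) = x * (1 + R \<omega> / L)" for x
          by (simp add: distrib_left)
        ultimately show ?thesis by (simp only:)
      qed
      also have "\<dots> \<le> sqrt (s * L / real n) * (1 + R \<omega> / L) + R \<omega> / real n"
        using b L R(2)[of \<omega>] n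
        by (intro add_right_mono mult_right_mono real_sqrt_le_mono divide_right_mono) auto
      finally show ?thesis by (simp add: b_def)
    qed
    \<comment> \<open>Both the empirical and the true mass of \<open>C\<close> are squeezed between
      those of the brackets; passing from a bracket to \<open>C\<close> costs at most
      \<open>e\<close> in true mass.\<close>
    have "N (Ain \<kappa>) \<le> N C" "N C \<le> N (Aout \<kappa>)" using N_mono \<kappa> by auto
    moreover note bound[of "Ain \<kappa>"] bound[of "Aout \<kappa>"] Q_mono s_le
    ultimately have "\<bar>N C - measure Q C\<bar> \<le> sqrt (s * L / real n) * (1 + R \<omega> / L) + R \<omega> / real n + e"
      unfolding s_def by auto
    moreover have "0 \<le> s" "s \<le> 1" by (simp_all add: s_def)
    moreover have "s \<le> measure Q C + e" using s_le Q_mono by linarith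
    ultimately show "\<exists>s. 0 \<le> s \<and> s \<le> 1 \<and> s \<le> (LINT x:C|lborel. pstar x) + e \<and>
        \<bar>(\<Sum>i<n. indicator C (X i \<omega>)) / real n - (LINT x:C|lborel. pstar x)\<bar>
          \<le> sqrt (s * L / real n) * (1 + R \<omega> / L) + R \<omega> / real n + e"
      unfolding N_def Q_int[OF C(2)] by blast
  qed
qed

section \<open>The risk bound\<close>

lemma Linf_norm_AE: "AE x in lborel. ennreal \<bar>f x\<bar> \<le> Linf_norm f"
  unfolding Linf_norm_def by (rule esssup_AE)

lemma Linf_norm_triangle:
  assumes f: "f \<in> borel_measurable borel" and g: "g \<in> borel_measurable borel"
  shows "Linf_norm (\<lambda>x. f x + g x) \<le> Linf_norm f + Linf_norm g"
proof -
  have "AE x in lborel. ennreal \<bar>f x + g x\<bar> \<le> Linf_norm f + Linf_norm g"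
    using Linf_norm_AE[of f] Linf_norm_AE[of g]
  proof eventually_elim
    case (elim x)
    have "ennreal \<bar>f x + g x\<bar> \<le> ennreal (\<bar>f x\<bar> + \<bar>g x\<bar>)"
      by (intro ennreal_leI abs_triangle_ineq)
    also have "\<dots> = ennreal \<bar>f x\<bar> + ennreal \<bar>g x\<bar>" by simp
    also have "\<dots> \<le> Linf_norm f + Linf_norm g" using elim by (rule add_mono)
    finally show ?case .
  qed
  then show ?thesis
    unfolding Linf_norm_def[of "\<lambda>x. f x + g x"] using f g by (intro esssup_I) auto
qed

lemma abs_set_integral_le_Linf_norm:
  assumes f: "integrable lborel f" and b: "Linf_norm f \<le> ennreal b" "0 \<le> b"
    and C: "C \<in> sets borel" "emeasure lborel C < \<infinity>"
  shows "\<bar>LINT x:C|lborel. f x\<bar> \<le> b * measure lborel C"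
proof -
  have fC: "set_integrable lborel C f"
    using integrable_mult_indicator[OF _ f, of C] C by (simp add: set_integrable_def)
  have ae: "AE x in lborel. \<bar>f x\<bar> \<le> b"
    using Linf_norm_AE[of f]
  proof (rule eventually_mono)
    fix x assume "ennreal \<bar>f x\<bar> \<le> Linf_norm f"
    then have "ennreal \<bar>f x\<bar> \<le> ennreal b" using b(1) by (rule order_trans)
    then show "\<bar>f x\<bar> \<le> b" using b(2) by simp
  qed
  have "\<bar>LINT x:C|lborel. f x\<bar> \<le> (LINT x:C|lborel. \<bar>f x\<bar>)"
    using fC set_integral_norm_bound[of lborel C f] by simp
  also have "\<dots> \<le> (LINT x:C|lborel. b)"
    using ae fC C by (intro set_integral_mono_AE set_integrable_abs) (auto simp: set_integrable_def)
  also have "\<dots> = b * measure lborel C"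
    using C by (simp add: set_integral_const)
  finally show ?thesis .
qed

lemma hun_T_eq:
  assumes n: "n \<ge> 1"
  shows "hun_T n h C X p q = hun_sign (C p q) p q *
    (((LINT x:C p q|lborel. p x) - (\<Sum>i<n. indicator (C p q) (X i)) / real n)
      / (measure lborel (C p q) + h))"
proof -
  have "hun_T n h C X p q = hun_sign (C p q) p q * (1 / (measure lborel (C p q) + h)) *
      ((1 / real n) * (\<Sum>i<n. (LINT x:C p q|lborel. p x) - indicator (C p q) (X i)))"
  proof -
    have "s * ((a - b) / w) = s * (1 / w) * (a - b)" for s a b w :: real by simp
    then show ?thesis unfolding hun_T_def by (simp only: sum_distrib_left[symmetric]) simp
  qed
  also have "(1 / real n) * (\<Sum>i<n. (LINT x:C p q|lborel. p x) - indicator (C p q) (X i))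
      = (LINT x:C p q|lborel. p x) - (\<Sum>i<n. indicator (C p q) (X i)) / real n"
    using n by (simp add: sum_subtractf diff_divide_distrib)
  finally show ?thesis by simp
qed

text \<open>A deterministic argument for one sample. Near-minimality, tested at
  \<open>q = pbar\<close>, bounds the statistic of \<open>(phat, pbar)\<close> by
  \<open>b + Z + \<delta>\<close>. It is also at least the normalised integral of
  \<open>phat - pbar\<close> minus \<open>b + Z\<close>. So that integral is at most
  \<open>2 b + 2 Z + \<delta>\<close>; \<open>sep\<close> doubles this, and the triangle inequality
  adds another \<open>b\<close>.\<close>

lemma hun_estimate_error:
  fixes m :: "(real ^ 'd \<Rightarrow> real) set"
  assumes n: "n \<ge> 1" and h: "h > 0"
    and m_int: "\<And>p. p \<in> m \<Longrightarrow> integrable lborel p" and pstar_int: "integrable lborel pstar"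
    and C_sets: "\<And>p q. p \<in> m \<Longrightarrow> q \<in> m \<Longrightarrow> C p q \<in> sets borel"
    and C_fin: "\<And>p q. p \<in> m \<Longrightarrow> q \<in> m \<Longrightarrow> emeasure lborel (C p q) < \<infinity>"
    and sep: "\<And>p q. p \<in> m \<Longrightarrow> q \<in> m \<Longrightarrow> Linf_norm (\<lambda>x. p x - q x)
      \<le> ennreal (2 * (\<bar>LINT x:C p q|lborel. p x - q x\<bar> / (measure lborel (C p q) + h)))"
    and Z: "\<And>p q. p \<in> m \<Longrightarrow> q \<in> m \<Longrightarrow>
      \<bar>(\<Sum>i<n. indicator (C p q) (X i)) / real n - (LINT x:C p q|lborel. pstar x)\<bar>
        \<le> Z * (measure lborel (C p q) + h)"
    and phat: "phat \<in> m"
      "hun_Tsup m n h C X phat \<le> (INF p\<in>m. hun_Tsup m n h C X p) + ereal \<delta>"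
    and pbar: "pbar \<in> m" "Linf_norm (\<lambda>x. pbar x - pstar x) \<le> ennreal b" "0 \<le> b"
  shows "Linf_norm (\<lambda>x. phat x - pstar x) \<le> ennreal (5 * b + 4 * Z + 2 * \<delta>)"
proof -
  have set_int: "set_integrable lborel (C p q) f" if "p \<in> m" "q \<in> m" "integrable lborel f" for p q
      and f :: "real ^ 'd \<Rightarrow> real"
    using integrable_mult_indicator[of "C p q" lborel f] C_sets that by (simp add: set_integrable_def)
  have pos: "measure lborel A + h > 0" for A using h by (simp add: add_nonneg_pos)
  define N where "N A = (\<Sum>i<n. indicator A (X i)) / real n" for A
  have bias: "\<bar>(LINT x:C p q|lborel. pbar x) - (LINT x:C p q|lborel. pstar x)\<bar>
      \<le> b * (measure lborel (C p q) + h)" if "p \<in> m" "q \<in> m" for p q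
  proof -
    have "\<bar>LINT x:C p q|lborel. pbar x - pstar x\<bar> \<le> b * measure lborel (C p q)"
      using pbar m_int pstar_int C_sets C_fin that by (intro abs_set_integral_le_Linf_norm) auto
    also have "\<dots> \<le> b * (measure lborel (C p q) + h)"
      using pbar(3) h by (intro mult_left_mono) auto
    finally show ?thesis using set_int[OF that] m_int pbar(1) pstar_int by simp
  qed
  have sign: "\<bar>hun_sign A p q\<bar> = 1" for A p q by (simp add: hun_sign_def)
  have "hun_T n h C X pbar q \<le> b + Z" if q: "q \<in> m" for q
  proof -
    let ?C = "C pbar q"
    have "hun_T n h C X pbar q \<le> \<bar>hun_sign ?C pbar q * (((LINT x:?C|lborel. pbar x) - N ?C)
        / (measure lborel ?C + h))\<bar>"
      unfolding hun_T_eq[OF n] N_def by (rule abs_ge_self)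
    also have "\<dots> = \<bar>(LINT x:?C|lborel. pbar x) - N ?C\<bar> / (measure lborel ?C + h)"
      using pos[of ?C] by (simp add: abs_mult sign)
    also have "\<dots> \<le> (b + Z) * (measure lborel ?C + h) / (measure lborel ?C + h)"
    proof (rule divide_right_mono)
      show "\<bar>(LINT x:?C|lborel. pbar x) - N ?C\<bar> \<le> (b + Z) * (measure lborel ?C + h)"
        using bias[OF pbar(1) q] Z[OF pbar(1) q] unfolding N_def distrib_right by linarith
    qed (use pos[of ?C] in simp)
    also have "\<dots> = b + Z" using pos[of ?C] by simp
    finally show ?thesis .
  qed
  then have "hun_Tsup m n h C X pbar \<le> ereal (b + Z)"
    unfolding hun_Tsup_def by (intro SUP_least) simp
  then have inf: "(INF p\<in>m. hun_Tsup m n h C X p) \<le> ereal (b + Z)"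
    using pbar(1) by (meson INF_lower order_trans)
  have "ereal (hun_T n h C X phat pbar) \<le> hun_Tsup m n h C X phat"
    unfolding hun_Tsup_def using pbar(1) by (intro SUP_upper)
  also note phat(2)
  also have "(INF p\<in>m. hun_Tsup m n h C X p) + ereal \<delta> \<le> ereal (b + Z) + ereal \<delta>"
    using inf by (rule add_right_mono)
  finally have T_up: "hun_T n h C X phat pbar \<le> b + Z + \<delta>" by simp
  define A where "A = C phat pbar"
  define \<tau> where "\<tau> = hun_sign A phat pbar"
  define D where "D = (LINT x:A|lborel. phat x - pbar x)"
  have D: "D = (LINT x:A|lborel. phat x) - (LINT x:A|lborel. pbar x)"
    unfolding D_def A_def using set_int[OF phat(1) pbar(1)] m_int phat(1) pbar(1) by simp
  have \<tau>D: "\<tau> * D = \<bar>D\<bar>" by (simp add: \<tau>_def hun_sign_def D_def)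
  \<comment> \<open>The sign in the statistic is that of \<open>D\<close> itself, so
    \<open>D\<close> contributes with its full absolute value and the two errors can only
    subtract.\<close>
  have "\<bar>D\<bar> - \<bar>(LINT x:A|lborel. pbar x) - (LINT x:A|lborel. pstar x)\<bar>
      - \<bar>N A - (LINT x:A|lborel. pstar x)\<bar> \<le> \<tau> * ((LINT x:A|lborel. phat x) - N A)"
  proof -
    define x where "x = (LINT x:A|lborel. pbar x) - (LINT x:A|lborel. pstar x)"
    define y where "y = N A - (LINT x:A|lborel. pstar x)"
    have "(LINT x:A|lborel. phat x) - N A = D + (x - y)" by (simp add: D x_def y_def)
    then have "\<tau> * ((LINT x:A|lborel. phat x) - N A) = \<bar>D\<bar> + \<tau> * (x - y)"
      by (simp only: distrib_left \<tau>D)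
    moreover have "\<bar>\<tau> * (x - y)\<bar> = \<bar>x - y\<bar>"
      unfolding abs_mult by (simp add: \<tau>_def sign)
    ultimately show ?thesis
      unfolding x_def[symmetric] y_def[symmetric]
      using abs_triangle_ineq4[of x y] abs_ge_minus_self[of "\<tau> * (x - y)"] by linarith
  qed
  also have "\<dots> = hun_T n h C X phat pbar * (measure lborel A + h)"
    using pos[of A] unfolding hun_T_eq[OF n] by (simp add: A_def[symmetric] \<tau>_def N_def)
  also have "\<dots> \<le> (b + Z + \<delta>) * (measure lborel A + h)"
    using T_up pos[of A] by (intro mult_right_mono) auto
  finally have "\<bar>D\<bar> \<le> (2 * b + 2 * Z + \<delta>) * (measure lborel A + h)"
    using bias[OF phat(1) pbar(1)] Z[OF phat(1) pbar(1)]
    unfolding A_def[symmetric] N_def distrib_right by linarith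
  then have D_le: "\<bar>D\<bar> / (measure lborel A + h) \<le> 2 * b + 2 * Z + \<delta>"
    using pos[of A] by (simp add: divide_le_eq)
  \<comment> \<open>\<open>ennreal\<close> sends negative reals to 0, so joining the sums at the end
    requires this sign; it is read off from \<open>D\<close>, since no sign of
    \<open>\<delta>\<close> is assumed.\<close>
  have "0 \<le> \<bar>D\<bar> / (measure lborel A + h)" using pos[of A] by simp
  then have nn: "0 \<le> 2 * b + 2 * Z + \<delta>" using D_le by linarith
  have "Linf_norm (\<lambda>x. phat x - pstar x) = Linf_norm (\<lambda>x. (phat x - pbar x) + (pbar x - pstar x))"
    by simp
  also have "\<dots> \<le> Linf_norm (\<lambda>x. phat x - pbar x) + Linf_norm (\<lambda>x. pbar x - pstar x)"
    using borel_measurable_integrable[OF m_int[OF phat(1)]] borel_measurable_integrable[OF m_int[OF pbar(1)]]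
      borel_measurable_integrable[OF pstar_int]
    by (intro Linf_norm_triangle) auto
  also have "\<dots> \<le> ennreal (2 * (\<bar>D\<bar> / (measure lborel A + h))) + ennreal b"
    using sep[OF phat(1) pbar(1)] pbar(2) unfolding A_def D_def by (rule add_mono)
  also have "\<dots> \<le> ennreal (2 * (2 * b + 2 * Z + \<delta>)) + ennreal b"
    using D_le by (intro add_right_mono ennreal_leI) simp
  also have "\<dots> = ennreal (5 * b + 4 * Z + 2 * \<delta>)"
    using nn pbar(3) by (subst ennreal_plus[symmetric]) (auto simp: algebra_simps)
  finally show ?thesis .
qed

text \<open>Here \<open>2 - 1 / sqrt 2\<close> is \<open>1 + \<kappa>\<close>. This comparison of
  the surviving height \<open>1 / sqrt 2\<close> with the enlarged volume yields the factor 2 in the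
  separation.\<close>

lemma one_plus_bandwidth_factor_le: "sqrt 2 * (2 - 1 / sqrt 2) \<le> (2 :: real)"
proof -
  have "sqrt 2 \<le> sqrt ((3 / 2)\<^sup>2 :: real)" by (rule real_sqrt_le_mono) (simp add: power2_eq_square)
  then have "2 * sqrt 2 \<le> (3 :: real)" by simp
  moreover have "sqrt 2 * (2 - 1 / sqrt 2) = 2 * sqrt 2 - (1 :: real)"
    by (simp add: right_diff_distrib)
  ultimately show ?thesis by simp
qed

text \<open>The lower bound gives \<open>t \<ge> 1 / (3 r)^2\<close>; the upper one keeps
  \<open>t\<close> in the range where the polynomial decay is available.\<close>

lemma bandwidth_factor_bounds:
  "2 / 9 \<le> (1 - 1 / sqrt 2 :: real)" "(1 - 1 / sqrt 2 :: real) \<le> 1 / 2"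
proof -
  have "9 / 7 \<le> sqrt (2 :: real)" by (rule real_le_rsqrt) (simp add: power2_eq_square)
  moreover have "sqrt 2 \<le> (2 :: real)" by (rule real_le_lsqrt) auto
  ultimately show "2 / 9 \<le> (1 - 1 / sqrt 2 :: real)" "(1 - 1 / sqrt 2 :: real) \<le> 1 / 2"
    by (auto simp: field_simps)
qed

text \<open>Here \<open>s\<close> is the mass of the outer bracket of a box of volume \<open>v\<close>, and the mass of the box is at
  most \<open>M * v\<close>.\<close>

lemma normalised_deviation_le:
  fixes s L R e M v h W n :: real
  assumes s: "0 \<le> s" "s \<le> 1" "s \<le> M * v + e" and e: "0 \<le> e" and M: "0 \<le> M"
    and L: "L > 0" and R: "R \<ge> 0" and n: "n > 0" and v: "0 \<le> v" "v \<le> v + h" and W: "W > 0" "1 / W \<le> v + h"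
  shows "sqrt (s * L / n) * (1 + R / L) + R / n + e
      \<le> (W * (sqrt (L / n) * (1 + R / L) + R / n + e)) * (v + h)" (is ?A)
    and "sqrt (s * L / n) * (1 + R / L) + R / n + e
      \<le> (sqrt (M * W * L / n) * (1 + R / L) + W * (sqrt (e * L / n) * (1 + R / L) + R / n + e)) * (v + h)" (is ?B)
proof -
  have Wvh: "1 \<le> W * (v + h)" using W by (simp add: divide_le_eq mult.commute)
  have vh: "v + h > 0" using W by (smt (verit) divide_pos_pos)
  have scale: "x \<le> (W * x) * (v + h)" if "x \<ge> 0" for x
    using mult_right_mono[OF Wvh that] by (simp add: mult_ac)
  have c: "0 \<le> 1 + R / L" using L R by simp
  have "sqrt (s * L / n) \<le> sqrt (1 * L / n)"
    using s L n by (intro real_sqrt_le_mono divide_right_mono mult_right_mono) auto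
  then have "sqrt (s * L / n) * (1 + R / L) \<le> sqrt (L / n) * (1 + R / L)"
    using c by (intro mult_right_mono) auto
  then have "sqrt (s * L / n) * (1 + R / L) + R / n + e \<le> sqrt (L / n) * (1 + R / L) + R / n + e"
    by simp
  also have "\<dots> \<le> (W * (sqrt (L / n) * (1 + R / L) + R / n + e)) * (v + h)"
    using c R n e L by (intro scale add_nonneg_nonneg mult_nonneg_nonneg) auto
  finally show ?A .
  have "sqrt (s * L / n) \<le> sqrt (M * v * L / n + e * L / n)"
  proof (rule real_sqrt_le_mono)
    have "s * L / n \<le> (M * v + e) * L / n"
      using s L n by (intro divide_right_mono mult_right_mono) auto
    then show "s * L / n \<le> M * v * L / n + e * L / n" by (simp add: distrib_right add_divide_distrib)
  qed
  also have "\<dots> \<le> sqrt (M * v * L / n) + sqrt (e * L / n)"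
    using M v L n e by (intro sqrt_add_le_add_sqrt) auto
  \<comment> \<open>From \<open>1 \<le> W * (v + h)\<close> follows
    \<open>v \<le> W * (v + h)^2\<close>. Taking the root turns the square into one factor
    \<open>v + h\<close> and costs only \<open>sqrt W\<close>, hence \<open>(3 r)^d\<close> rather
    than \<open>(3 r)^(2d)\<close>.\<close>
  also have "sqrt (M * v * L / n) \<le> sqrt (M * W * L / n) * (v + h)"
  proof -
    have "v \<le> v + h" by (rule v)
    also have "\<dots> \<le> W * (v + h) * (v + h)"
      using Wvh vh by (metis less_eq_real_def mult_right_mono mult_1)
    finally have "M * L / n * v \<le> M * L / n * (W * (v + h) * (v + h))"
      using M L n by (intro mult_left_mono) auto
    then have "M * v * L / n \<le> M * W * L / n * (v + h)\<^sup>2"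
      by (simp add: power2_eq_square mult_ac)
    then have "sqrt (M * v * L / n) \<le> sqrt (M * W * L / n * (v + h)\<^sup>2)"
      by (rule real_sqrt_le_mono)
    also have "\<dots> = sqrt (M * W * L / n) * (v + h)"
      unfolding real_sqrt_mult using vh by simp
    finally show ?thesis .
  qed
  finally have "sqrt (s * L / n) \<le> sqrt (M * W * L / n) * (v + h) + sqrt (e * L / n)"
    by simp
  then have "sqrt (s * L / n) * (1 + R / L)
      \<le> (sqrt (M * W * L / n) * (v + h) + sqrt (e * L / n)) * (1 + R / L)"
    using c by (rule mult_right_mono)
  also have "\<dots> = sqrt (M * W * L / n) * (1 + R / L) * (v + h) + sqrt (e * L / n) * (1 + R / L)"
  proof -
    have "(a * w + b) * c = a * c * w + b * c" for a b c w :: real by (simp add: algebra_simps)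
    then show ?thesis .
  qed
  finally have "sqrt (s * L / n) * (1 + R / L) + R / n + e
      \<le> sqrt (M * W * L / n) * (1 + R / L) * (v + h) + (sqrt (e * L / n) * (1 + R / L) + R / n + e)"
    by linarith
  also have "\<dots> \<le> sqrt (M * W * L / n) * (1 + R / L) * (v + h)
      + (W * (sqrt (e * L / n) * (1 + R / L) + R / n + e)) * (v + h)"
    using c R n e L by (intro add_left_mono scale add_nonneg_nonneg mult_nonneg_nonneg) auto
  finally show ?B by (simp add: distrib_right)
qed

text \<open>\<open>L + 1\<close> stands where the bound on the mean of \<open>R\<close> goes. As
  \<open>L = 2 T\<close> with \<open>T \<ge> 3\<close>, the factor \<open>2 + 1/L\<close> is at most
  3 and \<open>L + 1 \<le> 3 T\<close>. The estimates produce 16 and 24 in the first case and 40 and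
  24 in the second, well below 274 and 215.\<close>

lemma expected_deviation_constants:
  fixes T n W M e :: real
  defines "L \<equiv> 2 * T"
  assumes T: "T \<ge> 3" and n: "n > 0" and W: "W > 0" and M: "M \<ge> 0" and e: "0 \<le> e" "e \<le> T / n"
  shows "4 * (W * (sqrt (L / n) * (1 + (L + 1) / L) + (L + 1) / n + e))
      \<le> 274 * (W * (T / n)) + 215 * (W * sqrt (T / n))"
    and "4 * (sqrt (M * W * L / n) * (1 + (L + 1) / L)
        + W * (sqrt (e * L / n) * (1 + (L + 1) / L) + (L + 1) / n + e))
      \<le> 274 * (W * (T / n)) + 215 * sqrt (M * W * (T / n))"
proof -
  have fac: "0 \<le> 1 + (L + 1) / L" "1 + (L + 1) / L \<le> 3"
    using T unfolding L_def by (simp_all add: field_simps)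
  have sqrt2: "sqrt 2 \<le> (2 :: real)" by (rule real_le_lsqrt) auto
  have two: "sqrt (2 * x) \<le> 2 * sqrt x" if "x \<ge> 0" for x :: real
    using sqrt2 that by (simp add: real_sqrt_mult mult_right_mono)
  have Tn: "0 \<le> T / n" using T n by simp
  have lin: "(L + 1) / n + e \<le> 4 * (T / n)"
  proof -
    have "(L + 1) / n \<le> (3 * T) / n" using T n unfolding L_def by (intro divide_right_mono) auto
    then show ?thesis using e(2) by simp
  qed
  have "sqrt (L / n) \<le> 2 * sqrt (T / n)" using two[OF Tn] by (simp add: L_def)
  then have "sqrt (L / n) * (1 + (L + 1) / L) \<le> 2 * sqrt (T / n) * 3"
    using fac Tn by (intro mult_mono) auto
  then have "W * (sqrt (L / n) * (1 + (L + 1) / L) + (L + 1) / n + e) \<le> W * (6 * sqrt (T / n) + 4 * (T / n))"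
    using lin W by (intro mult_left_mono) auto
  also have "\<dots> = 6 * (W * sqrt (T / n)) + 4 * (W * (T / n))" by (simp add: algebra_simps)
  finally have "4 * (W * (sqrt (L / n) * (1 + (L + 1) / L) + (L + 1) / n + e))
      \<le> 4 * (6 * (W * sqrt (T / n)) + 4 * (W * (T / n)))" by simp
  moreover have "0 \<le> W * sqrt (T / n)" "0 \<le> W * (T / n)" using W Tn by (auto intro!: mult_nonneg_nonneg simp del: times_divide_eq_right)
  ultimately show "4 * (W * (sqrt (L / n) * (1 + (L + 1) / L) + (L + 1) / n + e))
      \<le> 274 * (W * (T / n)) + 215 * (W * sqrt (T / n))" by argo
  have MWT: "0 \<le> M * W * (T / n)" using M W Tn by (intro mult_nonneg_nonneg) auto
  have "sqrt (M * W * L / n) \<le> 2 * sqrt (M * W * (T / n))"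
    using two[OF MWT] by (simp add: L_def mult_ac)
  then have A: "sqrt (M * W * L / n) * (1 + (L + 1) / L) \<le> 2 * sqrt (M * W * (T / n)) * 3"
    using fac MWT by (intro mult_mono) auto
  \<comment> \<open>The bracketing gap is itself of order \<open>T / n\<close>, so its square-root
    contribution belongs to the linear term.\<close>
  have "e * L / n \<le> (2 * (T / n))\<^sup>2"
  proof -
    have "e * (L / n) \<le> (T / n) * (L / n)" using e T n by (intro mult_right_mono) (auto simp: L_def)
    also have "L / n = 2 * (T / n)" by (simp add: L_def)
    also have "(T / n) * (2 * (T / n)) \<le> 4 * ((T / n) * (T / n))"
      using mult_nonneg_nonneg[OF Tn Tn] by argo
    finally show ?thesis by (simp add: power2_eq_square L_def)
  qed
  then have "sqrt (e * L / n) \<le> 2 * (T / n)" using Tn by (intro real_le_lsqrt) auto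
  then have "sqrt (e * L / n) * (1 + (L + 1) / L) \<le> 2 * (T / n) * 3"
    using fac Tn by (intro mult_mono) auto
  then have "W * (sqrt (e * L / n) * (1 + (L + 1) / L) + (L + 1) / n + e) \<le> W * (10 * (T / n))"
    using lin W by (intro mult_left_mono) auto
  also have "\<dots> = 10 * (W * (T / n))" by (rule mult.left_commute)
  finally have "4 * (sqrt (M * W * L / n) * (1 + (L + 1) / L)
      + W * (sqrt (e * L / n) * (1 + (L + 1) / L) + (L + 1) / n + e))
      \<le> 4 * (2 * sqrt (M * W * (T / n)) * 3 + 10 * (W * (T / n)))"
    using A by (intro mult_left_mono add_mono) simp_all
  moreover have "0 \<le> sqrt (M * W * (T / n))" "0 \<le> W * (T / n)" using W MWT Tn by (auto intro!: mult_nonneg_nonneg simp del: times_divide_eq_right)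
  ultimately show "4 * (sqrt (M * W * L / n) * (1 + (L + 1) / L)
        + W * (sqrt (e * L / n) * (1 + (L + 1) / L) + (L + 1) / n + e))
      \<le> 274 * (W * (T / n)) + 215 * sqrt (M * W * (T / n))" by argo
qed

lemma (in prob_space) nn_integral_affine_le:
  assumes R: "R \<in> borel_measurable M" "\<And>\<omega>. 0 \<le> R \<omega>" and int: "(\<integral>\<^sup>+\<omega>. ennreal (R \<omega>) \<partial>M) \<le> ennreal K"
    and ab: "0 \<le> a" "0 \<le> b" and K: "0 \<le> K"
  shows "(\<integral>\<^sup>+\<omega>. ennreal (a + b * R \<omega>) \<partial>M) \<le> ennreal (a + b * K)"
proof -
  have "(\<integral>\<^sup>+\<omega>. ennreal (a + b * R \<omega>) \<partial>M) = (\<integral>\<^sup>+\<omega>. ennreal a + ennreal b * ennreal (R \<omega>) \<partial>M)"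
    using R(2) ab by (simp add: ennreal_mult)
  also have "\<dots> = ennreal a + ennreal b * (\<integral>\<^sup>+\<omega>. ennreal (R \<omega>) \<partial>M)"
    using R(1) by (simp add: nn_integral_add nn_integral_cmult emeasure_space_1)
  also have "\<dots> \<le> ennreal a + ennreal b * ennreal K"
    using int by (intro add_left_mono mult_left_mono) auto
  also have "\<dots> = ennreal (a + b * K)" using ab K by (simp add: ennreal_mult)
  finally show ?thesis .
qed

lemma integrable_density_lborel:
  fixes p :: "real ^ 'd \<Rightarrow> real"
  assumes "prob_space P" "distributed P lborel X (\<lambda>x. ennreal (p x))" "\<And>x. 0 \<le> p x"
  shows "integrable lborel p"
proof (rule integrableI_nonneg)
  interpret P: prob_space P by (rule assms(1))
  show "p \<in> borel_measurable lborel"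
    using distributed_real_measurable[OF _ assms(2)] assms(3) by simp
  have "(\<integral>\<^sup>+x. ennreal (p x) \<partial>lborel) = emeasure P (X -` UNIV \<inter> space P)"
    using distributed_emeasure[OF assms(2), of UNIV] by simp
  also have "\<dots> \<le> 1" by (rule P.emeasure_le_1)
  finally show "(\<integral>\<^sup>+x. ennreal (p x) \<partial>lborel) < \<infinity>"
    by (simp add: le_less_trans[of _ 1])
qed (use assms(3) in simp)

text \<open>Guarantees that \<open>enn2real\<close> in the risk bound returns the true norm of the
  average density; at infinity it would return 0.\<close>

lemma Linf_norm_average_finite:
  fixes p :: "nat \<Rightarrow> 'a :: euclidean_space \<Rightarrow> real"
  assumes meas: "\<And>i. i < n \<Longrightarrow> p i \<in> borel_measurable borel"
    and fin: "\<And>i. i < n \<Longrightarrow> Linf_norm (p i) < \<infinity>"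
  shows "Linf_norm (\<lambda>x. (1 / real n) * (\<Sum>i<n. p i x)) < \<infinity>"
proof -
  define b where "b i = enn2real (Linf_norm (p i))" for i
  have "AE x in lborel. \<forall>i\<in>{..<n}. ennreal \<bar>p i x\<bar> \<le> ennreal (b i)"
  proof (rule AE_finite_allI)
    fix i assume "i \<in> {..<n}"
    then have "ennreal (b i) = Linf_norm (p i)" using fin[of i] by (simp add: b_def)
    then show "AE x in lborel. ennreal \<bar>p i x\<bar> \<le> ennreal (b i)"
      using Linf_norm_AE[of "p i"] by simp
  qed simp
  then have "AE x in lborel. ennreal \<bar>(1 / real n) * (\<Sum>i<n. p i x)\<bar> \<le> ennreal ((1 / real n) * (\<Sum>i<n. b i))"
  proof (rule eventually_mono)
    fix x assume "\<forall>i\<in>{..<n}. ennreal \<bar>p i x\<bar> \<le> ennreal (b i)"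
    then have le: "\<bar>p i x\<bar> \<le> b i" if "i < n" for i using that by (simp add: b_def)
    have "\<bar>\<Sum>i<n. p i x\<bar> \<le> (\<Sum>i<n. b i)"
      using le by (intro order_trans[OF sum_abs] sum_mono) auto
    then show "ennreal \<bar>(1 / real n) * (\<Sum>i<n. p i x)\<bar> \<le> ennreal ((1 / real n) * (\<Sum>i<n. b i))"
      unfolding abs_mult by (intro ennreal_leI mult_mono) auto
  qed
  moreover have "(\<lambda>x. (1 / real n) * (\<Sum>i<n. p i x)) \<in> borel_measurable borel"
    using meas by (intro borel_measurable_times borel_measurable_sum) auto
  moreover have "(\<lambda>x. ennreal \<bar>f x\<bar>) \<in> borel_measurable lborel"
    if "f \<in> borel_measurable borel" for f :: "'a \<Rightarrow> real"
    using that by measurable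
  ultimately have "Linf_norm (\<lambda>x. (1 / real n) * (\<Sum>i<n. p i x)) \<le> ennreal ((1 / real n) * (\<Sum>i<n. b i))"
    unfolding Linf_norm_def by (intro esssup_I)
  then show ?thesis by (simp add: le_less_trans)
qed

text \<open>The infimum over the model need not be attained, and elements at infinite distance are
  excluded from the premise. An infinite right side is trivial; otherwise some element comes within
  \<open>\<epsilon> / 5\<close> of the infimum.\<close>

lemma ennreal_le_mult_INF_add:
  fixes E K :: ennreal and F :: "'a \<Rightarrow> ennreal"
  assumes le: "\<And>x. x \<in> A \<Longrightarrow> F x < \<infinity> \<Longrightarrow> E \<le> 5 * F x + K" 
  shows "E \<le> 5 * (INF x\<in>A. F x) + K"
proof (rule ennreal_le_epsilon)
  fix \<epsilon> :: real assume fin: "5 * (INF x\<in>A. F x) + K < top" and \<epsilon>: "0 < \<epsilon>"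
  then have "(INF x\<in>A. F x) < top"
    by (metis ennreal_mult_top ennreal_add_eq_top less_top zero_neq_numeral)
  then have "(INF x\<in>A. F x) \<noteq> \<infinity>" by (metis infinity_ennreal_def less_irrefl)
  moreover have "v < v + ennreal (\<epsilon> / 5)" if "v \<noteq> \<infinity>" for v
    using \<epsilon> that ennreal_add_left_cancel_less[of v 0 "ennreal (\<epsilon> / 5)"] by simp
  ultimately have "(INF x\<in>A. F x) < (INF x\<in>A. F x) + ennreal (\<epsilon> / 5)" by blast
  then obtain x where x: "x \<in> A" "F x < (INF x\<in>A. F x) + ennreal (\<epsilon> / 5)"
    by (auto simp: INF_less_iff)
  have "F x < \<infinity>" using x(2) by (metis infinity_ennreal_def less_top top.extremum_strict order_less_le_trans top_greatest)
  then have "E \<le> 5 * F x + K" using x(1) le by blast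
  also have "\<dots> \<le> 5 * ((INF x\<in>A. F x) + ennreal (\<epsilon> / 5)) + K"
    using x(2) by (intro add_right_mono mult_left_mono) auto
  also have "5 * ((INF x\<in>A. F x) + ennreal (\<epsilon> / 5)) = 5 * (INF x\<in>A. F x) + 5 * ennreal (\<epsilon> / 5)"
    by (rule distrib_left)
  also have "5 * ennreal (\<epsilon> / 5) = ennreal \<epsilon>"
    using \<epsilon> by (subst ennreal_numeral[symmetric], subst ennreal_mult[symmetric]) auto
  finally show "E \<le> 5 * (INF x\<in>A. F x) + K + ennreal \<epsilon>" by (simp add: ac_simps)
qed

theorem corollary1:
  fixes P :: "'w measure"
    and X :: "nat \<Rightarrow> 'w \<Rightarrow> real ^ 'd"
    and p :: "nat \<Rightarrow> real ^ 'd \<Rightarrow> real"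
    and pstar :: "real ^ 'd \<Rightarrow> real"
    and n r d :: nat
    and \<I> :: "(real ^ 'd) set set"
    and m :: "(real ^ 'd \<Rightarrow> real) set"
    and h0 hm \<delta> :: real
    and Istar :: "(real ^ 'd \<Rightarrow> real) \<Rightarrow> (real ^ 'd) set"
    and fstar :: "(real ^ 'd \<Rightarrow> real) \<Rightarrow> real ^ 'd \<Rightarrow> real"
    and xstar :: "(real ^ 'd \<Rightarrow> real) \<Rightarrow> real ^ 'd"
    and p_hat :: "'w \<Rightarrow> real ^ 'd \<Rightarrow> real"
  assumes d: "d = CARD('d)"
    and r: "r \<ge> 1"
    and n: "n \<ge> 1"
    and P: "prob_space P"
    and indep: "prob_space.indep_vars P (\<lambda>_. borel) X {..<n}"
    and dens: "\<And>i. i < n \<Longrightarrow> distributed P lborel (X i) (\<lambda>x. ennreal (p i x))"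
    and dens_nonneg: "\<And>i x. i < n \<Longrightarrow> 0 \<le> p i x"
    and dens_Linf: "\<And>i. i < n \<Longrightarrow> Linf_norm (p i) < \<infinity>"
    and pstar: "pstar = (\<lambda>x. (1 / real n) * (\<Sum>i<n. p i x))"
    and cells: "\<I> \<subseteq> interval_products"
    and countable: "countable \<I>"
    and partition: "partition_on UNIV \<I>"
    and partition_asm: "partition_assumption interval_products \<I> h0"
    and m: "m = pw_rat_polys r \<I>"
    and hm: "hm = (1 - 1 / sqrt 2) ^ (d + 1) / (2 * real r ^ 2) ^ d * h0"
    and peak: "\<And>f. f \<in> m \<Longrightarrow> is_peak r \<I> f (Istar f) (fstar f) (xstar f)"
    and \<delta>: "\<delta> > 0"
    and p_hat: "hun_estimator P m n hm
      (\<lambda>p q. peak_set (theta r d h0 hm) (Istar (\<lambda>x. p x - q x)) (xstar (\<lambda>x. p x - q x)))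
      X \<delta> p_hat"
  shows "(\<integral>\<^sup>+ \<omega>. Linf_norm (\<lambda>x. p_hat \<omega> x - pstar x) \<partial>P)
    \<le> 5 * (INF p\<in>m. Linf_norm (\<lambda>x. p x - pstar x))
      + ennreal (274 * (2 * real d + 1) * (3 * real r) ^ (2 * d)
                   * (ln (exp 1 * real n) / (h0 * real n))
                 + 2 * \<delta>
                 + 215 * sqrt (2 * real d + 1) *
                     min ((3 * real r) ^ d * sqrt (enn2real (Linf_norm pstar))
                            * sqrt (ln (exp 1 * real n) / (h0 * real n)))
                         ((3 * real r) ^ (2 * d)
                            * (sqrt (ln (exp 1 * real n)) / (h0 * sqrt (real n)))))"
proof -
  interpret P: prob_space P by (rule P)
  define \<kappa> :: real where "\<kappa> = 1 - 1 / sqrt 2"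
  define t where "t = theta r d h0 hm"
  define C where "C p q = peak_set t (Istar (\<lambda>x. p x - q x)) (xstar (\<lambda>x. p x - q x))"
    for p q :: "real ^ 'd \<Rightarrow> real"
  define W where "W = (3 * real r) ^ (2 * d) / h0"
  have d1: "d \<ge> 1" by (simp add: d)
  have h0: "h0 > 0" using partition_asm by (simp add: partition_assumption_def)
  have r2: "(real r)\<^sup>2 \<ge> 1" using r by simp
  have \<kappa>: "2 / 9 \<le> \<kappa>" "\<kappa> \<le> 1 / 2"
    unfolding \<kappa>_def by (rule bandwidth_factor_bounds)+
  have t: "t = \<kappa> / (2 * (real r)\<^sup>2)"
    unfolding t_def \<kappa>_def using r d1 h0 hm by (rule theta_bandwidth)
  have t0: "0 < t" unfolding t using \<kappa> r2 by (intro divide_pos_pos) linarith+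
  have t_le: "t \<le> 1 / (real r)\<^sup>2"
    using divide_right_mono[of "\<kappa> / 2" 1 "(real r)\<^sup>2"] \<kappa>(2) by (simp add: t)
  have "1 / (real r)\<^sup>2 \<le> 1" using r2 by (subst divide_le_eq_1_pos) linarith+
  then have t1: "t \<le> 1" using t_le by linarith
  \<comment> \<open>The bandwidth is \<open>\<kappa>\<close> times the smallest possible volume of a
    box, which is how it can be absorbed in the volume below.\<close>
  have hm_eq: "hm = \<kappa> * (t ^ d * h0)"
    unfolding hm t by (simp add: \<kappa>_def power_divide)
  have hm0: "hm > 0" unfolding hm_eq using \<kappa> t0 h0 by simp
  have W0: "W > 0" unfolding W_def using r h0 by simp
  have W_le: "1 / W \<le> t ^ d * h0"
  proof -
    have "1 / (3 * real r)\<^sup>2 \<le> t"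
      using divide_right_mono[of "1 / 9" "\<kappa> / 2" "(real r)\<^sup>2"] \<kappa>(1) by (simp add: t power_mult_distrib)
    then have "(1 / (3 * real r)\<^sup>2) ^ d \<le> t ^ d" by (intro power_mono) auto
    then have "(1 / (3 * real r)\<^sup>2) ^ d * h0 \<le> t ^ d * h0" using h0 by (intro mult_right_mono) auto
    then show ?thesis by (simp add: W_def power_divide power_mult)
  qed
  have cell: "convex I" "bounded I" "I \<in> sets borel" "h0 \<le> measure lborel I" "measure lborel I > 0"
    "(\<lambda>y. x + s *\<^sub>R y) ` interior I \<in> interval_products" if "I \<in> \<I>" "s > 0" for I x and s :: real
    using that partition_asm h0 cells sets_borel_interval_products
    unfolding partition_assumption_def by (force, force, force, force, force, blast)
  have m_int: "integrable lborel q" if "q \<in> m" for q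
    using that cell(2,3)[OF _ zero_less_one] unfolding m by (intro integrable_pw_rat_polys) auto
  have m_diff: "(\<lambda>x. f x - g x) \<in> m" if "f \<in> m" "g \<in> m" for f g
    using that unfolding m by (rule pw_rat_polys_diff)
  have C_props: "C f g \<in> interval_products" "open (C f g)" "C f g \<noteq> {}" "emeasure lborel (C f g) < \<infinity>"
      "t ^ d * h0 \<le> measure lborel (C f g)"
      "Linf_norm (\<lambda>x. f x - g x)
        \<le> ennreal (2 * (\<bar>LINT x:C f g|lborel. f x - g x\<bar> / (measure lborel (C f g) + hm)))"
    if fg: "f \<in> m" "g \<in> m" for f g
  proof -
    define u where "u = (\<lambda>x. f x - g x)"
    define I where "I = Istar u"
    define x where "x = xstar u"
    have u: "u \<in> m" unfolding u_def using fg by (rule m_diff)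
    have pk: "is_peak r \<I> u I (fstar u) x" unfolding I_def x_def using u by (rule peak)
    then have I: "I \<in> \<I>" "x \<in> closure I" by (auto simp: is_peak_def)
    have C: "C f g = peak_set t I x" by (simp add: C_def u_def I_def x_def)
    note cI = cell(1,2,3,5)[OF I(1) zero_less_one]
    note props = peak_set_properties[OF cI I(2) t0 t1, folded C]
    show "C f g \<in> interval_products"
      using cell(6)[OF I(1) t0] unfolding C peak_set_def by blast
    show "open (C f g)" by (rule props(1))
    show "emeasure lborel (C f g) < \<infinity>" using props(2) by (rule emeasure_bounded_finite)
    show vol: "t ^ d * h0 \<le> measure lborel (C f g)"
      unfolding props(3) d using cell(4)[OF I(1) zero_less_one] t0 by (intro mult_left_mono) auto
    have v0: "0 < t ^ d * h0" using t0 h0 by simp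
    then show "C f g \<noteq> {}" using vol by auto
    define v where "v = measure lborel (C f g)"
    define S where "S = \<bar>LINT x:C f g|lborel. u x\<bar>"
    have v: "v > 0" "v + hm > 0" using vol v0 hm0 by (auto simp: v_def)
    have "1 - 2 * (real r)\<^sup>2 * t = 1 / sqrt 2" using r by (simp add: t \<kappa>_def)
    then have S: "1 / sqrt 2 * \<bar>fstar u x\<bar> * v \<le> S"
      using integral_peak_set_ge[OF r m_int[OF u] cI pk t0 t_le] by (simp add: C v_def S_def)
    have "v + hm \<le> (1 + \<kappa>) * v"
      unfolding hm_eq using vol \<kappa> by (simp add: distrib_right v_def mult_left_mono)
    then have "\<bar>fstar u x\<bar> * (v + hm) \<le> \<bar>fstar u x\<bar> * ((1 + \<kappa>) * v)"
      by (intro mult_left_mono) auto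
    also have "\<dots> = sqrt 2 * (1 + \<kappa>) * (1 / sqrt 2 * \<bar>fstar u x\<bar> * v)" by simp
    also have "\<dots> \<le> 2 * (1 / sqrt 2 * \<bar>fstar u x\<bar> * v)"
      using one_plus_bandwidth_factor_le v unfolding \<kappa>_def by (intro mult_right_mono) auto
    also have "\<dots> \<le> 2 * S" using S by simp
    finally have "\<bar>fstar u x\<bar> \<le> 2 * (S / (v + hm))"
      using v by (simp add: le_divide_eq)
    moreover have "Linf_norm u \<le> ennreal \<bar>fstar u x\<bar>"
      using borel_measurable_integrable[OF m_int[OF u]] countable partition cI(3) pk
      by (intro Linf_norm_le_peak) (auto simp: partition_on_def)
    ultimately show "Linf_norm (\<lambda>x. f x - g x)
        \<le> ennreal (2 * (\<bar>LINT x:C f g|lborel. f x - g x\<bar> / (measure lborel (C f g) + hm)))"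
      unfolding S_def v_def u_def[symmetric] by (meson ennreal_leI order_trans)
  qed
  have C_borel: "C f g \<in> sets borel" if "f \<in> m" "g \<in> m" for f g
    using C_props(2)[OF that] by simp

  have p_int: "integrable lborel (p i)" if "i < n" for i
    using P dens[OF that] dens_nonneg[OF that] by (rule integrable_density_lborel)
  have pstar_int: "integrable lborel pstar"
    unfolding pstar using p_int by (intro integrable_mult_right Bochner_Integration.integrable_sum) auto
  define M where "M = enn2real (Linf_norm pstar)"
  have "Linf_norm pstar < \<infinity>"
    unfolding pstar using borel_measurable_integrable[OF p_int] dens_Linf
    by (intro Linf_norm_average_finite) auto
  then have M_eq: "Linf_norm pstar = ennreal M" by (simp add: M_def)
  have M0: "0 \<le> M" by (simp add: M_def)

  define ln_en where "ln_en = ln (exp 1 * real n)"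
  define T where "T = (2 * real d + 1) * ln_en"
  define L where "L = 2 * T"
  define e where "e = 2 * real d / real n"
  have n0: "real n > 0" using n by simp
  have ln_en: "ln_en \<ge> 1" unfolding ln_en_def using n by (simp add: ln_mult)
  have "3 * 1 \<le> T" unfolding T_def using ln_en d1 by (intro mult_mono) auto
  then have T: "T \<ge> 3" by simp
  then have L0: "L > 0" by (simp add: L_def)
  have e0: "0 \<le> e" by (simp add: e_def)
  have eT: "e \<le> T / real n"
  proof -
    have "2 * real d * 1 \<le> (2 * real d + 1) * ln_en" using ln_en by (intro mult_mono) auto
    then show ?thesis unfolding e_def T_def by (intro divide_right_mono) auto
  qed
  have L_eq: "2 * (2 * real CARD('d) + 1) * ln (exp 1 * real n) = L"
    by (simp add: L_def T_def ln_en_def d)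
  obtain R :: "'w \<Rightarrow> real" where R: "R \<in> borel_measurable P" "\<And>\<omega>. 0 \<le> R \<omega>"
    "(\<integral>\<^sup>+\<omega>. ennreal (R \<omega>) \<partial>P) \<le> ennreal (L + 1)"
    and dev: "\<And>\<omega> A. A \<in> interval_products \<Longrightarrow> A \<in> sets borel \<Longrightarrow> A \<noteq> {} \<Longrightarrow>
      \<exists>s. 0 \<le> s \<and> s \<le> 1 \<and> s \<le> (LINT x:A|lborel. pstar x) + e \<and>
        \<bar>(\<Sum>i<n. indicator A (X i \<omega>)) / real n - (LINT x:A|lborel. pstar x)\<bar>
          \<le> sqrt (s * L / real n) * (1 + R \<omega> / L) + R \<omega> / real n + e"
    using P.empirical_deviation_interval_products[OF n indep dens dens_nonneg,
        folded pstar, unfolded L_eq, folded d, folded e_def]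
    by blast
  \<comment> \<open>One form for both terms of the minimum: \<open>a\<close> is already normalised,
    whereas \<open>b\<close> still pays the factor \<open>W\<close>. The pairs used are
    \<open>sqrt (M W L / n)\<close> with \<open>sqrt (e L / n)\<close>, and 0 with
    \<open>sqrt (L / n)\<close>. Being affine in \<open>y\<close>, it is integrated through the mean
    of \<open>R\<close> alone.\<close>
  define Z where "Z a b y = a * (1 + y / L) + W * (b * (1 + y / L) + y / real n + e)" for a b y
  have Z_affine: "Z a b y = (a + W * (b + e)) + (a / L + W * (b / L + 1 / real n)) * y" for a b y
    by (simp add: Z_def algebra_simps)

  have risk: "(\<integral>\<^sup>+ \<omega>. Linf_norm (\<lambda>x. p_hat \<omega> x - pstar x) \<partial>P)
      \<le> 5 * Linf_norm (\<lambda>x. pbar x - pstar x) + ennreal (4 * Z a b (L + 1) + 2 * \<delta>)"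
    if pbar: "pbar \<in> m" "Linf_norm (\<lambda>x. pbar x - pstar x) < \<infinity>" and ab: "0 \<le> a" "0 \<le> b"
      and Z_ge: "\<And>s v y. 0 \<le> s \<Longrightarrow> s \<le> 1 \<Longrightarrow> s \<le> M * v + e \<Longrightarrow> 0 \<le> v \<Longrightarrow> 1 / W \<le> v + hm \<Longrightarrow> 0 \<le> y \<Longrightarrow>
        sqrt (s * L / real n) * (1 + y / L) + y / real n + e \<le> Z a b y * (v + hm)"
    for pbar a b
  proof -
    define \<beta> where "\<beta> = enn2real (Linf_norm (\<lambda>x. pbar x - pstar x))"
    have \<beta>: "Linf_norm (\<lambda>x. pbar x - pstar x) = ennreal \<beta>" "0 \<le> \<beta>"
      using pbar(2) by (simp_all add: \<beta>_def)
    have "Linf_norm (\<lambda>x. p_hat \<omega> x - pstar x) \<le> ennreal (5 * \<beta> + 4 * Z a b (R \<omega>) + 2 * \<delta>)"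
      if \<omega>: "\<omega> \<in> space P" for \<omega>
    proof (rule hun_estimate_error[where C = C and X = "\<lambda>i. X i \<omega>", OF n hm0 m_int pstar_int C_borel C_props(4) C_props(6)])
      fix f g assume fg: "f \<in> m" "g \<in> m"
      define v where "v = measure lborel (C f g)"
      obtain s where s: "0 \<le> s" "s \<le> 1" "s \<le> (LINT x:C f g|lborel. pstar x) + e"
        "\<bar>(\<Sum>i<n. indicator (C f g) (X i \<omega>)) / real n - (LINT x:C f g|lborel. pstar x)\<bar>
          \<le> sqrt (s * L / real n) * (1 + R \<omega> / L) + R \<omega> / real n + e"
        using dev[OF C_props(1)[OF fg] C_borel[OF fg] C_props(3)[OF fg]] by blast
      have "\<bar>LINT x:C f g|lborel. pstar x\<bar> \<le> M * v"
        unfolding v_def using pstar_int M_eq M0 C_borel[OF fg] C_props(4)[OF fg]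
        by (intro abs_set_integral_le_Linf_norm) auto
      then have "s \<le> M * v + e" using s(3) by linarith
      moreover have "1 / W \<le> v + hm"
        using W_le C_props(5)[OF fg] hm0 by (simp add: v_def)
      ultimately have "sqrt (s * L / real n) * (1 + R \<omega> / L) + R \<omega> / real n + e \<le> Z a b (R \<omega>) * (v + hm)"
        using s R(2) by (intro Z_ge) (auto simp: v_def)
      then show "\<bar>(\<Sum>i<n. indicator (C f g) (X i \<omega>)) / real n - (LINT x:C f g|lborel. pstar x)\<bar>
          \<le> Z a b (R \<omega>) * (measure lborel (C f g) + hm)"
        using s(4) unfolding v_def by linarith
    next
      show "p_hat \<omega> \<in> m"
        using p_hat \<omega> unfolding hun_estimator_def by (auto dest: measurable_space)
      show "hun_Tsup m n hm C (\<lambda>i. X i \<omega>) (p_hat \<omega>) \<le> (INF p\<in>m. hun_Tsup m n hm C (\<lambda>i. X i \<omega>) p) + ereal \<delta>"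
        using p_hat \<omega> unfolding hun_estimator_def C_def t_def by blast
      show "pbar \<in> m" by (rule pbar(1))
      show "Linf_norm (\<lambda>x. pbar x - pstar x) \<le> ennreal \<beta>" "0 \<le> \<beta>" using \<beta> by simp_all
    qed
    then have "(\<integral>\<^sup>+ \<omega>. Linf_norm (\<lambda>x. p_hat \<omega> x - pstar x) \<partial>P)
        \<le> (\<integral>\<^sup>+ \<omega>. ennreal (5 * \<beta> + 4 * Z a b (R \<omega>) + 2 * \<delta>) \<partial>P)"
      by (intro nn_integral_mono)
    also have "\<dots> = (\<integral>\<^sup>+ \<omega>. ennreal ((5 * \<beta> + 4 * (a + W * (b + e)) + 2 * \<delta>)
        + 4 * (a / L + W * (b / L + 1 / real n)) * R \<omega>) \<partial>P)"
      unfolding Z_affine by (simp add: distrib_left ac_simps)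
    also have "\<dots> \<le> ennreal ((5 * \<beta> + 4 * (a + W * (b + e)) + 2 * \<delta>)
        + 4 * (a / L + W * (b / L + 1 / real n)) * (L + 1))"
      using R L0 W0 ab e0 n0 \<beta>(2) \<delta>
      by (intro P.nn_integral_affine_le add_nonneg_nonneg mult_nonneg_nonneg divide_nonneg_nonneg) auto
    also have "(5 * \<beta> + 4 * (a + W * (b + e)) + 2 * \<delta>) + 4 * (a / L + W * (b / L + 1 / real n)) * (L + 1)
        = 5 * \<beta> + (4 * Z a b (L + 1) + 2 * \<delta>)"
      unfolding Z_affine by (simp add: distrib_left)
    also have "ennreal \<dots> = 5 * Linf_norm (\<lambda>x. pbar x - pstar x) + ennreal (4 * Z a b (L + 1) + 2 * \<delta>)"
    proof -
      have "0 \<le> Z a b (L + 1)"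
        unfolding Z_def using ab W0 L0 e0 n0
        by (intro add_nonneg_nonneg mult_nonneg_nonneg divide_nonneg_nonneg) auto
      then have "ennreal (5 * \<beta> + (4 * Z a b (L + 1) + 2 * \<delta>)) = ennreal (5 * \<beta>) + ennreal (4 * Z a b (L + 1) + 2 * \<delta>)"
        using \<beta>(2) \<delta> by (intro ennreal_plus) auto
      also have "ennreal (5 * \<beta>) = 5 * ennreal \<beta>" using \<beta>(2) by (simp add: ennreal_mult)
      finally show ?thesis by (simp add: \<beta>(1))
    qed
    finally show ?thesis .
  qed

  define lin where "lin = 274 * (2 * real d + 1) * (3 * real r) ^ (2 * d) * (ln (exp 1 * real n) / (h0 * real n))"
  define B1 where "B1 = sqrt (2 * real d + 1) * ((3 * real r) ^ d * sqrt M * sqrt (ln (exp 1 * real n) / (h0 * real n)))"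
  define B2 where "B2 = sqrt (2 * real d + 1) * ((3 * real r) ^ (2 * d) * (sqrt (ln (exp 1 * real n)) / (h0 * sqrt (real n))))"
  have lin: "274 * (W * (T / real n)) = lin"
    by (simp add: lin_def W_def T_def ln_en_def)
  have B2: "W * sqrt (T / real n) = B2"
    by (simp add: B2_def W_def T_def ln_en_def real_sqrt_divide real_sqrt_mult)
  have B1: "sqrt (M * W * (T / real n)) = B1"
  proof -
    have sq: "((3 * real r) ^ d)\<^sup>2 = (3 * real r) ^ (2 * d)"
      by (simp only: power_mult[symmetric] mult.commute[of d])
    have "M * W * (T / real n)
        = (2 * real d + 1) * (((3 * real r) ^ d)\<^sup>2 * M * (ln (exp 1 * real n) / (h0 * real n)))"
      unfolding sq by (simp add: W_def T_def ln_en_def)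
    then show ?thesis unfolding B1_def by (simp only: real_sqrt_mult real_sqrt_abs) simp
  qed
  have "(\<integral>\<^sup>+ \<omega>. Linf_norm (\<lambda>x. p_hat \<omega> x - pstar x) \<partial>P)
      \<le> 5 * Linf_norm (\<lambda>x. pbar x - pstar x) + ennreal (lin + 2 * \<delta> + 215 * min B1 B2)"
    if pbar: "pbar \<in> m" "Linf_norm (\<lambda>x. pbar x - pstar x) < \<infinity>" for pbar
  \<comment> \<open>Both bounds are deterministic, so the better pair of parameters can be chosen
    before integrating, and the minimum stands outside the expectation.\<close>
  proof (cases "B1 \<le> B2")
    case True
    let ?a = "sqrt (M * W * L / real n)" and ?b = "sqrt (e * L / real n)"
    have "4 * Z ?a ?b (L + 1) + 2 * \<delta> \<le> lin + 2 * \<delta> + 215 * min B1 B2"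
      using expected_deviation_constants(2)[OF T n0 W0 M0 e0 eT] True
      unfolding Z_def lin B1 L_def by simp
    moreover have "(\<integral>\<^sup>+ \<omega>. Linf_norm (\<lambda>x. p_hat \<omega> x - pstar x) \<partial>P)
        \<le> 5 * Linf_norm (\<lambda>x. pbar x - pstar x) + ennreal (4 * Z ?a ?b (L + 1) + 2 * \<delta>)"
      using pbar
    proof (rule risk)
      show "sqrt (s * L / real n) * (1 + y / L) + y / real n + e \<le> Z ?a ?b y * (v + hm)"
        if "0 \<le> s" "s \<le> 1" "s \<le> M * v + e" "0 \<le> v" "1 / W \<le> v + hm" "0 \<le> y" for s v y
        unfolding Z_def using that e0 M0 L0 n0 W0 hm0 by (intro normalised_deviation_le(2)) auto
    qed (use M0 W0 L0 e0 n0 in auto)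
    ultimately show ?thesis by (meson add_left_mono ennreal_leI order_trans)
  next
    case False
    let ?b = "sqrt (L / real n)"
    have "4 * Z 0 ?b (L + 1) + 2 * \<delta> \<le> lin + 2 * \<delta> + 215 * min B1 B2"
      using expected_deviation_constants(1)[OF T n0 W0 M0 e0 eT] False
      unfolding Z_def lin B2 L_def by simp
    moreover have "(\<integral>\<^sup>+ \<omega>. Linf_norm (\<lambda>x. p_hat \<omega> x - pstar x) \<partial>P)
        \<le> 5 * Linf_norm (\<lambda>x. pbar x - pstar x) + ennreal (4 * Z 0 ?b (L + 1) + 2 * \<delta>)"
      using pbar
    proof (rule risk)
      show "sqrt (s * L / real n) * (1 + y / L) + y / real n + e \<le> Z 0 ?b y * (v + hm)"
        if "0 \<le> s" "s \<le> 1" "s \<le> M * v + e" "0 \<le> v" "1 / W \<le> v + hm" "0 \<le> y" for s v y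
        using normalised_deviation_le(1)[of s M v e L y "real n" hm W] that e0 M0 L0 n0 W0 hm0
        by (simp add: Z_def)
    qed (use L0 n0 in auto)
    ultimately show ?thesis by (meson add_left_mono ennreal_leI order_trans)
  qed
  then have "(\<integral>\<^sup>+ \<omega>. Linf_norm (\<lambda>x. p_hat \<omega> x - pstar x) \<partial>P)
      \<le> 5 * (INF p\<in>m. Linf_norm (\<lambda>x. p x - pstar x)) + ennreal (lin + 2 * \<delta> + 215 * min B1 B2)"
    by (rule ennreal_le_mult_INF_add)
  moreover have "215 * min B1 B2 = 215 * sqrt (2 * real d + 1) *
      min ((3 * real r) ^ d * sqrt M * sqrt (ln (exp 1 * real n) / (h0 * real n)))
        ((3 * real r) ^ (2 * d) * (sqrt (ln (exp 1 * real n)) / (h0 * sqrt (real n))))"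
    unfolding B1_def B2_def by (simp add: min_mult_distrib_left)
  ultimately show ?thesis unfolding lin_def M_def by simp
qed

end
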